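(* Let $\Gamma<\mathrm{GL}(n,\mathbf{Z})$ be a torsion free, virtually unipotent subgroup. Then there exists a torsion free, finite index subgroup $\Lambda_0$ of $\mathrm{GL}(n,\mathbf{Z})$ such that $\Gamma < \Lambda_0$.
   Context: A subgroup of $\mathrm{GL}(n,\mathbf{C})$ is unipotent if it is conjugate in $\mathrm{GL}(n,\mathbf{C})$ into the group of upper triangular matrices with ones on the diagonal, and virtually unipotent if it has a finite index unipotent subgroup. *)

theory Defs
  imports "Jordan_Normal_Form.Matrix" "HOL-Algebra.Coset" "HOL.Complex"
begin

definition GL :: "'a::comm_ring_1 itself \<Rightarrow> nat \<Rightarrow> 'a mat monoid" where
  "GL ty n = units_of (ring_mat ty n ())"

lemma group_GL: "group (GL TYPE('a::comm_ring_1) n)"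
proof -
  interpret ring "ring_mat TYPE('a) n ()" by (rule ring_mat)
  show ?thesis unfolding GL_def by (rule units_group)
qed

lemma carrier_GL:
  "carrier (GL TYPE('a::comm_ring_1) n) =
     {A \<in> carrier_mat n n. \<exists>B \<in> carrier_mat n n. B * A = 1\<^sub>m n \<and> A * B = 1\<^sub>m n}"
  unfolding GL_def units_of_carrier Units_def by (simp add: ring_mat_simps)

lemma mult_GL: "mult (GL TYPE('a::comm_ring_1) n) = (*)"
  unfolding GL_def units_of_mult by (simp add: ring_mat_simps)

lemma one_GL: "one (GL TYPE('a::comm_ring_1) n) = 1\<^sub>m n"
  unfolding GL_def units_of_one by (simp add: ring_mat_simps)

definition torsion_free :: "('a, 'b) monoid_scheme \<Rightarrow> 'a set \<Rightarrow> bool" where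
  "torsion_free G H \<longleftrightarrow> (\<forall>x\<in>H. \<forall>k::nat. 0 < k \<longrightarrow> x [^]\<^bsub>G\<^esub> k = \<one>\<^bsub>G\<^esub> \<longrightarrow> x = \<one>\<^bsub>G\<^esub>)"

definition finite_index_subgroup :: "'a set \<Rightarrow> ('a, 'b) monoid_scheme \<Rightarrow> bool" where
  "finite_index_subgroup H G \<longleftrightarrow> subgroup H G \<and> finite (rcosets\<^bsub>G\<^esub> H)"

definition upper_unitriangular :: "'a::{zero,one} itself \<Rightarrow> nat \<Rightarrow> 'a mat set" where
  "upper_unitriangular ty n =
     {A \<in> carrier_mat n n. upper_triangular A \<and> (\<forall>i<n. A $$ (i, i) = 1)}"

definition unipotent_subgroup :: "nat \<Rightarrow> complex mat set \<Rightarrow> bool" where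
  "unipotent_subgroup n U \<longleftrightarrow>
     subgroup U (GL TYPE(complex) n) \<and>
     (\<exists>P \<in> carrier (GL TYPE(complex) n). \<forall>g\<in>U.
        P \<otimes>\<^bsub>GL TYPE(complex) n\<^esub> g \<otimes>\<^bsub>GL TYPE(complex) n\<^esub> inv\<^bsub>GL TYPE(complex) n\<^esub> P
          \<in> upper_unitriangular TYPE(complex) n)"

definition virtually_unipotent :: "nat \<Rightarrow> complex mat set \<Rightarrow> bool" where
  "virtually_unipotent n H \<longleftrightarrow>
     subgroup H (GL TYPE(complex) n) \<and>
     (\<exists>U. finite_index_subgroup U ((GL TYPE(complex) n)\<lparr>carrier := H\<rparr>) \<and>
          unipotent_subgroup n U)"

definition complexify :: "int mat \<Rightarrow> complex mat" where
  "complexify = map_mat of_int"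

lemma complexify_hom: "complexify \<in> hom (GL TYPE(int) n) (GL TYPE(complex) n)"
proof (rule homI)
  have m: "complexify (A * B) = complexify A * complexify B"
    if "A \<in> carrier_mat n n" "B \<in> carrier_mat n n" for A B
    unfolding complexify_def using that by (rule of_int_hom.mat_hom_mult)
  have o: "complexify (1\<^sub>m n) = 1\<^sub>m n"
    unfolding complexify_def by (rule of_int_hom.mat_hom_one)
  have c: "complexify A \<in> carrier_mat n n" if "A \<in> carrier_mat n n" for A
    using that by (simp add: complexify_def)
  show "complexify A \<in> carrier (GL TYPE(complex) n)"
    if A: "A \<in> carrier (GL TYPE(int) n)" for A
  proof -
    from A obtain B where AB: "A \<in> carrier_mat n n" "B \<in> carrier_mat n n"
        "B * A = 1\<^sub>m n" "A * B = 1\<^sub>m n"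
      unfolding carrier_GL by blast
    then have "complexify B * complexify A = 1\<^sub>m n" "complexify A * complexify B = 1\<^sub>m n"
      by (simp_all add: m[symmetric] o)
    with AB show ?thesis unfolding carrier_GL using c by blast
  qed
  show "complexify (A \<otimes>\<^bsub>GL TYPE(int) n\<^esub> B) = complexify A \<otimes>\<^bsub>GL TYPE(complex) n\<^esub> complexify B"
    if "A \<in> carrier (GL TYPE(int) n)" "B \<in> carrier (GL TYPE(int) n)" for A B
    using that m unfolding carrier_GL mult_GL by blast
qed

end

theory Submission
  imports Defs "HOL-Computational_Algebra.Primes" "HOL-Library.FuncSet"
begin

text \<open>Let \<open>U\<close> be a unipotent subgroup of finite index in \<open>\<Gamma>\<close>, normal in \<open>\<Gamma>\<close>, and let \<open>D\<close> be such
  that \<open>g ^ D \<in> U\<close> for all \<open>g \<in> \<Gamma>\<close> and \<open>t ^ D = 1\<close> for all torsion elements \<open>t\<close> of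
  \<open>GL(n,\<int>)\<close>. The subgroup \<open>\<Lambda>\<^sub>0\<close> is \<open>\<Gamma>\<close> times a principal congruence subgroup of deep level.
  If \<open>t \<in> \<Lambda>\<^sub>0\<close> is torsion, then \<open>t\<close> is congruent to some \<open>x \<in> \<Gamma>\<close>, and \<open>x ^ D \<in> U\<close> is close to 1.
  Take a \<open>\<Gamma>\<close>-invariant filtration of \<open>U\<close> whose quotients are torsion-free abelian; elements close
  to 1 are highly divisible in them. Going down this filtration, one divides \<open>x\<close> successively by
  elements of \<open>U\<close> close to 1, until its \<open>D\<close>-th power is 1. As \<open>\<Gamma>\<close> is torsion free the modified
  \<open>x\<close> is 1, hence \<open>t\<close> is congruent to 1 modulo 6, and this forces \<open>t = 1\<close>.\<close>

subsection \<open>Subgroups of finite index\<close>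

text \<open>Elements sharing a value of \<open>f\<close> lie in one coset of \<open>H\<close>, so
  choosing one representative per value reaches every coset.\<close>

lemma (in group) finite_rcosetsI:
  assumes H: "subgroup H G" and fin: "finite (f ` carrier G)"
    and f: "\<And>x y. x \<in> carrier G \<Longrightarrow> y \<in> carrier G \<Longrightarrow> f x = f y \<Longrightarrow> x \<otimes> inv y \<in> H"
  shows "finite (rcosets H)"
proof -
  define r where "r y = (SOME x. x \<in> carrier G \<and> f x = y)" for y
  have r: "r (f x) \<in> carrier G \<and> f (r (f x)) = f x" if "x \<in> carrier G" for x
    unfolding r_def by (rule someI[of _ x]) (use that in simp)
  have "H #> x = H #> r (f x)" if x: "x \<in> carrier G" for x
  proof -
    have "x \<otimes> inv (r (f x)) \<in> H" using f x r by metis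
    moreover have "x = (x \<otimes> inv (r (f x))) \<otimes> r (f x)" using x r by (simp add: m_assoc)
    ultimately have "x \<in> H #> r (f x)" unfolding r_coset_def by blast
    then show ?thesis using repr_independence r x H by metis
  qed
  then have "rcosets H \<subseteq> (\<lambda>y. H #> r y) ` f ` carrier G"
    unfolding RCOSETS_def by blast
  then show ?thesis using fin finite_surj by blast
qed

lemma (in group) subgroup_nat_pow_closed:
  assumes "subgroup H G" "h \<in> H"
  shows "h [^] (k::nat) \<in> H"
  using assms by (induction k) (auto intro: subgroup.one_closed subgroup.m_closed)

text \<open>By pigeonhole, two of the powers of \<open>g\<close> with exponents from 0 to the index
  K lie in the same coset, so \<open>g\<close> to some power d with 0 < d \<le> K lies in
  \<open>H\<close>. As d divides the factorial of K, that factorial serves all \<open>g\<close> at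
  once.\<close>

lemma (in group) finite_index_exponent:
  assumes H: "subgroup H G" and fin: "finite (rcosets H)"
  shows "\<exists>N>0. \<forall>g\<in>carrier G. g [^] (N::nat) \<in> H"
proof (intro exI conjI ballI)
  let ?K = "card (rcosets H)"
  show "0 < (fact ?K :: nat)" by simp
  fix g assume g: "g \<in> carrier G"
  have "(\<lambda>i::nat. H #> g [^] i) ` {..?K} \<subseteq> rcosets H"
    using g unfolding RCOSETS_def by blast
  then have "card ((\<lambda>i::nat. H #> g [^] i) ` {..?K}) < card {..?K}"
    using card_mono[OF fin] by (simp add: less_Suc_eq_le)
  then have "\<not> inj_on (\<lambda>i::nat. H #> g [^] i) {..?K}" by (metis card_image less_irrefl)
  then obtain i j :: nat where ij: "i < j" "j \<le> ?K" "H #> g [^] i = H #> g [^] j"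
    unfolding inj_on_def by (metis atMost_iff nat_neq_iff)
  have "g [^] j \<in> H #> g [^] i" using rcos_self[OF _ H] ij g by simp
  then obtain h where h: "h \<in> H" "g [^] j = h \<otimes> g [^] i" unfolding r_coset_def by blast
  moreover have "g [^] j = g [^] (j - i) \<otimes> g [^] i" using ij g by (simp add: nat_pow_mult)
  ultimately have "g [^] (j - i) \<in> H"
    using right_cancel[of "g [^] i" h "g [^] (j - i)"] g subgroup.mem_carrier[OF H] by auto
  moreover have "(j - i) dvd fact ?K" using ij by (intro dvd_fact) auto
  then obtain q where "fact ?K = (j - i) * q" by (auto simp: dvd_def)
  ultimately have "(g [^] (j - i)) [^] q \<in> H \<and> g [^] (fact ?K :: nat) = (g [^] (j - i)) [^] q"
    using g subgroup_nat_pow_closed[OF H] by (metis nat_pow_pow)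
  then show "g [^] (fact ?K :: nat) \<in> H" by simp
qed

lemma (in group) conj_nat_pow:
  assumes "x \<in> carrier G" "g \<in> carrier G"
  shows "x \<otimes> g [^] (k::nat) \<otimes> inv x = (x \<otimes> g \<otimes> inv x) [^] k"
proof (induction k)
  case (Suc k)
  have "x \<otimes> g [^] Suc k \<otimes> inv x = (x \<otimes> g [^] k \<otimes> inv x) \<otimes> (x \<otimes> g \<otimes> inv x)"
    using assms by (simp add: m_assoc flip: m_assoc[of "inv x" x])
  then show ?case using Suc by simp
qed (use assms in simp)

subsection \<open>Congruences in a ring with a lattice ideal\<close>

lemma additive_int_generator:
  fixes Z :: "int set"
  assumes "0 \<in> Z" and diff: "\<And>a b. a \<in> Z \<Longrightarrow> b \<in> Z \<Longrightarrow> a - b \<in> Z"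
    and mul: "\<And>m a. a \<in> Z \<Longrightarrow> m * a \<in> Z"
  shows "\<exists>e\<in>Z. 0 \<le> e \<and> (\<forall>a\<in>Z. e dvd a)"
proof (cases "Z \<subseteq> {0}")
  case True
  then show ?thesis using assms(1) by auto
next
  case False
  then obtain a where a: "a \<in> Z" "a \<noteq> 0" by auto
  have "\<bar>a\<bar> \<in> Z" using a mul[of a "-1"] by (auto simp: abs_if)
  then have ex: "\<exists>k. 0 < k \<and> int k \<in> Z" using a by (intro exI[of _ "nat \<bar>a\<bar>"]) auto
  define k where "k = (LEAST k. 0 < k \<and> int k \<in> Z)"
  have k: "0 < k" "int k \<in> Z" using LeastI_ex[OF ex] unfolding k_def by auto
  have "int k dvd b" if b: "b \<in> Z" for b
  proof (rule ccontr)
    assume "\<not> int k dvd b"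
    then have nz: "b mod int k \<noteq> 0" by auto
    have "b - (b div int k) * int k \<in> Z" using diff b mul k by blast
    then have "b mod int k \<in> Z" by (simp add: minus_div_mult_eq_mod)
    moreover have "0 \<le> b mod int k" "b mod int k < int k" using k by auto
    ultimately have "0 < nat (b mod int k) \<and> int (nat (b mod int k)) \<in> Z" "nat (b mod int k) < k"
      using nz by auto
    then show False using not_less_Least[of "nat (b mod int k)" "\<lambda>k. 0 < k \<and> int k \<in> Z"]
      unfolding k_def[symmetric] by blast
  qed
  then show ?thesis using k by (intro bexI[of _ "int k"]) auto
qed

lemma additive_of_int_mult:
  fixes f :: "'r::ring_1 \<Rightarrow> int"
  assumes add: "\<And>a b. f (a + b) = f a + f b"
  shows "f (of_int N * a) = N * f a"
proof (induction N rule: int_induct[where k = 0])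
  case base
  show ?case using add[of 0 0] by simp
next
  case (step1 i)
  then show ?case by (simp add: algebra_simps add)
next
  case (step2 i)
  then show ?case using add[of "of_int (i - 1) * a" a] by (simp add: algebra_simps)
qed

lemma additive_subgroup_divisible:
  fixes F :: "('r::ring_1 \<Rightarrow> int) set" and A :: "'r set"
  assumes "finite F" and "\<And>f a b. f \<in> F \<Longrightarrow> f (a + b) = f a + f b"
    and "0 \<in> A" "\<And>a b. a \<in> A \<Longrightarrow> b \<in> A \<Longrightarrow> a + b \<in> A"
    and "\<And>a m. a \<in> A \<Longrightarrow> of_int m * a \<in> A" and "0 < N"
  shows "\<exists>M>0. \<forall>a\<in>A. (\<forall>f\<in>F. M dvd f a) \<longrightarrow> (\<exists>b\<in>A. \<forall>f\<in>F. f a = N * f b)"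
  using assms(1-5)
proof (induction F arbitrary: A rule: finite_induct)
  case empty
  then show ?case by (intro exI[of _ 1]) auto
next
  case (insert f F)
  have add: "\<And>h a b. h \<in> insert f F \<Longrightarrow> h (a + b) = h a + h b"
    and mulA: "\<And>a m. a \<in> A \<Longrightarrow> of_int m * a \<in> A"
    and addA: "\<And>a b. a \<in> A \<Longrightarrow> b \<in> A \<Longrightarrow> a + b \<in> A"
    using insert.prems by blast+
  have mul: "h (of_int m * a) = m * h a" if "h \<in> insert f F" for h m a
    using additive_of_int_mult add that by blast
  have diffA: "a - of_int m * b \<in> A" if "a \<in> A" "b \<in> A" for a b m
    using addA[OF that(1) mulA[OF that(2), of "-m"]] by simp
  have diff: "h (a - of_int m * b) = h a - m * h b" if "h \<in> insert f F" for h a b m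
    using add[OF that, of a "of_int (-m) * b"] mul[OF that, of "-m" b] by simp
  have zero: "f 0 = 0" using mul[of f 0 0] by simp
  have "\<exists>e\<in>f ` A. 0 \<le> e \<and> (\<forall>a\<in>f ` A. e dvd a)"
  proof (rule additive_int_generator)
    show "0 \<in> f ` A" using zero insert.prems(2) by force
    show "a - b \<in> f ` A" if "a \<in> f ` A" "b \<in> f ` A" for a b
    proof -
      from that obtain x y where "x \<in> A" "y \<in> A" "a = f x" "b = f y" by blast
      then have "a - b = f (x - of_int 1 * y)" "x - of_int 1 * y \<in> A"
        using diff[of f x 1 y] diffA[of x y 1] by auto
      then show ?thesis by blast
    qed
    show "m * a \<in> f ` A" if "a \<in> f ` A" for m a
    proof -
      from that obtain x where "x \<in> A" "a = f x" by blast
      then have "m * a = f (of_int m * x)" "of_int m * x \<in> A"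
        using mul[of f m x] mulA by auto
      then show ?thesis by blast
    qed
  qed
  then obtain a0 where a0: "a0 \<in> A" "0 \<le> f a0" and gen: "\<And>a. a \<in> A \<Longrightarrow> f a0 dvd f a" by auto
  define A' where "A' = {a \<in> A. f a = 0}"
  have "\<exists>M>0. \<forall>a\<in>A'. (\<forall>f\<in>F. M dvd f a) \<longrightarrow> (\<exists>b\<in>A'. \<forall>f\<in>F. f a = N * f b)"
  proof (rule insert.IH)
    show "0 \<in> A'" using zero insert.prems by (simp add: A'_def)
    show "a + b \<in> A'" if "a \<in> A'" "b \<in> A'" for a b
      using that add[of f a b] addA by (simp add: A'_def)
    show "of_int m * a \<in> A'" if "a \<in> A'" for a m
      using that mul[of f m a] mulA by (simp add: A'_def)
  qed (use add in blast)
  then obtain M where M: "M > 0"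
    and IH: "\<forall>a\<in>A'. (\<forall>f\<in>F. M dvd f a) \<longrightarrow> (\<exists>b\<in>A'. \<forall>f\<in>F. f a = N * f b)"
    by (elim exE conjE) (rule that)
  \<comment> \<open>If \<open>f\<close> vanishes on \<open>A\<close>, the generator is 0 and 1 takes
    its place, so that the modulus \<open>e * (N * M)\<close> stays positive.\<close>
  define e where "e = (if f a0 = 0 then 1 else f a0)"
  have e: "e > 0" using a0 by (auto simp: e_def)
  have "\<exists>b\<in>A. \<forall>h\<in>insert f F. h a = N * h b"
    if a: "a \<in> A" and dvd: "\<forall>h\<in>insert f F. e * (N * M) dvd h a" for a
  proof -
    \<comment> \<open>The factor \<open>M\<close> keeps the other coordinates of the difference
      \<open>c\<close> divisible by \<open>M\<close>; the factor \<open>N\<close> makes the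
      subtracted term \<open>N\<close> times an element of \<open>A\<close>.\<close>
    obtain m where m: "f a = f a0 * (N * M * m)"
    proof (cases "f a0 = 0")
      case True
      then have "f a = f a0 * (N * M * 0)" using gen[OF a] by simp
      then show ?thesis using that by blast
    next
      case False
      then show ?thesis using dvd that by (auto simp: e_def dvd_def mult.assoc)
    qed
    define c where "c = a - of_int (N * M * m) * a0"
    have hc: "h c = h a - N * M * m * h a0" if "h \<in> insert f F" for h
      unfolding c_def using diff[OF that] by blast
    have "c \<in> A" unfolding c_def using diffA a a0 by blast
    then have cA: "c \<in> A'" using hc[of f] m by (simp add: A'_def)
    have "M dvd h c" if "h \<in> F" for h
    proof -
      have "M dvd h a" using dvd that by (meson dvd_mult_right insertCI)
      then show ?thesis using hc[of h] that by simp
    qed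
    then obtain b where b: "b \<in> A'" "\<And>h. h \<in> F \<Longrightarrow> h c = N * h b" using IH cA by blast
    have "h a = N * h (b + of_int (M * m) * a0)" if h: "h \<in> insert f F" for h
    proof -
      have "h c = N * h b" using h b cA by (auto simp: A'_def)
      then show ?thesis using hc[OF h] add[OF h] mul[OF h] by (simp add: algebra_simps)
    qed
    moreover have "b + of_int (M * m) * a0 \<in> A"
      using addA[OF _ mulA[OF a0(1)]] b(1) unfolding A'_def by blast
    ultimately show ?thesis by blast
  qed
  then show ?case using e M \<open>0 < N\<close> by (intro exI[of _ "e * (N * M)"]) auto
qed

section \<open>Congruences modulo \<open>m\<close> in a lattice, and torsion near 1\<close>

locale lattice_ring =
  fixes S :: "'r::ring_1 set" and F :: "('r \<Rightarrow> int) set"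
  assumes finite_F: "finite F"
    and F_add: "f \<in> F \<Longrightarrow> f (a + b) = f a + f b"
    and zero_S: "0 \<in> S"
    and add_S: "a \<in> S \<Longrightarrow> b \<in> S \<Longrightarrow> a + b \<in> S"
    and uminus_S: "a \<in> S \<Longrightarrow> - a \<in> S"
    and mult_S: "a \<in> S \<Longrightarrow> b \<in> S \<Longrightarrow> a * b \<in> S"
    and F_inj: "a \<in> S \<Longrightarrow> \<forall>f\<in>F. f a = 0 \<Longrightarrow> a = 0"
begin

text \<open>\<open>S\<close> is additively embedded by \<open>F\<close> in a finite power of the
  integers and need not contain 1. Invertible matrices will therefore be represented in the coset 1
  + \<open>S\<close>, and congruences are taken modulo \<open>m\<close> times \<open>S\<close>, not
  modulo \<open>m\<close> times the whole ring.\<close>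

definition one_plus :: "'r set" where "one_plus = {g. g - 1 \<in> S}"

definition mcong :: "int \<Rightarrow> 'r \<Rightarrow> 'r \<Rightarrow> bool" where
  "mcong m x y \<longleftrightarrow> (\<exists>s\<in>S. x - y = of_int m * s)"

lemma F_mult: "f \<in> F \<Longrightarrow> f (of_int m * a) = m * f a"
  using additive_of_int_mult F_add by blast

lemma diff_S: "a \<in> S \<Longrightarrow> b \<in> S \<Longrightarrow> a - b \<in> S"
  using add_S[of a "- b"] uminus_S by simp

lemma of_int_S: "a \<in> S \<Longrightarrow> of_int m * a \<in> S"
proof (induction m rule: int_induct[where k = 0])
  case base
  show ?case using zero_S by simp
next
  case (step1 i)
  then show ?case using add_S by (simp add: algebra_simps)
next
  case (step2 i)
  then show ?case using diff_S by (simp add: algebra_simps)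
qed

lemma torsion_free_S:
  assumes "a \<in> S" "m \<noteq> 0" "of_int m * a = 0"
  shows "a = 0"
proof (rule F_inj[OF assms(1)], intro ballI)
  fix f assume f: "f \<in> F"
  have "m * f a = f 0" using F_mult[OF f, of m a] assms by simp
  then show "f a = 0" using F_mult[OF f, of 0 0] assms by simp
qed

lemma one_one_plus: "1 \<in> one_plus" using zero_S by (simp add: one_plus_def)

lemma mult_one_plus_right: "a \<in> S \<Longrightarrow> g \<in> one_plus \<Longrightarrow> a * g \<in> S"
  using add_S[OF mult_S[of a "g - 1"], of a] by (simp add: one_plus_def algebra_simps)

lemma mult_one_plus_left: "a \<in> S \<Longrightarrow> g \<in> one_plus \<Longrightarrow> g * a \<in> S"
  using add_S[OF mult_S[of "g - 1" a], of a] by (simp add: one_plus_def algebra_simps)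

lemma mult_one_plus: "g \<in> one_plus \<Longrightarrow> h \<in> one_plus \<Longrightarrow> g * h \<in> one_plus"
  using add_S[OF mult_one_plus_right[of "g - 1" h], of "h - 1"] by (simp add: one_plus_def algebra_simps)

lemma power_one_plus: "g \<in> one_plus \<Longrightarrow> g ^ k \<in> one_plus"
  by (induction k) (auto intro: one_one_plus mult_one_plus)

lemma mcong_refl: "mcong m x x"
  unfolding mcong_def using zero_S by force

lemma mcong_sym: "mcong m x y \<Longrightarrow> mcong m y x"
  unfolding mcong_def using uminus_S by (metis minus_diff_eq mult_minus_right)

lemma mcong_trans: "mcong m x y \<Longrightarrow> mcong m y z \<Longrightarrow> mcong m x z"
  unfolding mcong_def
proof (elim bexE)
  fix s t assume "s \<in> S" "t \<in> S" "x - y = of_int m * s" "y - z = of_int m * t"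
  then show "\<exists>s\<in>S. x - z = of_int m * s"
    by (intro bexI[of _ "s + t"]) (auto simp: add_S distrib_left diff_eq_eq add.assoc add.commute)
qed

lemma mcong_mult_right: "mcong m x y \<Longrightarrow> g \<in> one_plus \<Longrightarrow> mcong m (x * g) (y * g)"
  unfolding mcong_def using mult_one_plus_right by (metis left_diff_distrib mult.assoc)

lemma mcong_mult_left: "mcong m x y \<Longrightarrow> g \<in> one_plus \<Longrightarrow> mcong m (g * x) (g * y)"
  unfolding mcong_def using mult_one_plus_left
  by (metis right_diff_distrib mult.assoc mult_of_int_commute)

lemma mcong_dvd: "mcong m x y \<Longrightarrow> k dvd m \<Longrightarrow> mcong k x y"
  unfolding mcong_def using of_int_S by (metis dvd_def mult.assoc of_int_mult)

lemma mcong_mult: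
  "mcong m x y \<Longrightarrow> mcong m x' y' \<Longrightarrow> y \<in> one_plus \<Longrightarrow> x' \<in> one_plus \<Longrightarrow> mcong m (x * x') (y * y')"
  using mcong_mult_left mcong_mult_right mcong_trans by blast

lemma mcong_power: "mcong m x y \<Longrightarrow> x \<in> one_plus \<Longrightarrow> y \<in> one_plus \<Longrightarrow> mcong m (x ^ k) (y ^ k)"
  by (induction k) (auto intro: mcong_refl mcong_mult power_one_plus)

lemma F_dvd_of_mcong: "mcong m x y \<Longrightarrow> f \<in> F \<Longrightarrow> m dvd f (x - y)"
  unfolding mcong_def using F_mult by force

text \<open>The cofactor is the geometric sum of the powers of \<open>s\<close> with exponents below
  \<open>m\<close>, and each of its \<open>m\<close> terms is congruent to 1 modulo
  \<open>l\<close>.\<close>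

lemma power_diff_one_factor:
  assumes s: "s \<in> one_plus" and r: "r \<in> S" "s - 1 = of_int l * r"
  shows "\<exists>X\<in>S. s ^ m - 1 = (s - 1) * (of_nat m + of_int l * X)"
proof (induction m)
  case 0
  show ?case using zero_S by (intro bexI[of _ 0]) auto
next
  case (Suc m)
  then obtain X where X: "X \<in> S" "s ^ m - 1 = (s - 1) * (of_nat m + of_int l * X)" by blast
  have "s ^ Suc m - 1 = (s ^ m - 1) * s + (s - 1)"
    by (simp add: algebra_simps power_commutes)
  also have "\<dots> = (s - 1) * ((of_nat m + of_int l * X) * s + 1)"
    by (simp add: X algebra_simps)
  also have "(of_nat m + of_int l * X) * s + 1
      = of_nat m * (s - 1) + of_nat (Suc m) + of_int l * (X * s)"
    by (simp add: algebra_simps)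
  also have "of_nat m * (s - 1) = of_int l * (of_int (int m) * r)"
    by (simp add: r mult.assoc mult_of_nat_commute)
  finally have "s ^ Suc m - 1 = (s - 1) * (of_nat (Suc m) + of_int l * (of_int (int m) * r + X * s))"
    by (simp add: algebra_simps)
  moreover have "of_int (int m) * r + X * s \<in> S"
    using add_S of_int_S mult_one_plus_right r X s by blast
  ultimately show ?case by blast
qed

text \<open>This is Minkowski's argument. For \<open>l\<close> prime to \<open>p\<close>, the
  factorization of \<open>s ^ p - 1 = 0\<close> gives
  \<open>p * (s - 1) = - l * ((s - 1) * X)\<close>. Iterating, every coordinate of
  \<open>s - 1\<close> is divisible by all powers of \<open>l\<close>, hence is 0.\<close>

lemma mcong_one_prime_torsion:
  assumes s: "s \<in> one_plus" "mcong 6 s 1" and p: "prime p" "s ^ p = 1"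
  shows "s = 1"
proof -
  \<comment> \<open>The level 6 offers both 2 and 3, and at least one of them is prime to
    \<open>p\<close>.\<close>
  obtain l :: int where l: "l dvd 6" "coprime l (int p)" "l > 1"
  proof (cases "p = 2")
    case True
    then show ?thesis using that[of 3] by simp
  next
    case False
    then have "coprime (int 2) (int p)"
      using p primes_coprime[of 2 p] two_is_prime_nat unfolding coprime_int_iff by auto
    then show ?thesis using that[of 2] by simp
  qed
  obtain r where r: "r \<in> S" "s - 1 = of_int l * r"
    using mcong_dvd[OF s(2) l(1)] unfolding mcong_def by blast
  obtain X where X: "X \<in> S" "s ^ p - 1 = (s - 1) * (of_nat p + of_int l * X)"
    using power_diff_one_factor[OF s(1) r] by blast
  have key: "of_int (int p) * (s - 1) = of_int (- l) * ((s - 1) * X)"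
  proof -
    have "(s - 1) * of_nat p + (s - 1) * (of_int l * X) = 0"
      using X p by (simp add: distrib_left)
    moreover have "(s - 1) * (of_int l * X) = of_int l * ((s - 1) * X)"
      by (metis mult.assoc mult_of_int_commute)
    ultimately show ?thesis
      by (metis add_eq_0_iff2 minus_mult_left mult_of_nat_commute of_int_minus of_int_of_nat_eq)
  qed
  \<comment> \<open>Powers of \<open>X\<close> are carried along because each new factor
    \<open>l\<close> is paid for by passing from \<open>X ^ i\<close> to
    \<open>X ^ Suc i\<close>.\<close>
  have "l ^ j dvd f ((s - 1) * X ^ i)" if f: "f \<in> F" for f i j
  proof (induction j arbitrary: i)
    case (Suc j)
    have "of_int (int p) * ((s - 1) * X ^ i) = of_int (- l) * ((s - 1) * X ^ Suc i)"
    proof -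
      have "of_int (int p) * ((s - 1) * X ^ i) = of_int (int p) * (s - 1) * X ^ i"
        by (simp only: mult.assoc)
      then show ?thesis by (simp only: key power_Suc mult.assoc)
    qed
    then have "int p * f ((s - 1) * X ^ i) = - l * f ((s - 1) * X ^ Suc i)"
      using F_mult[OF f] by metis
    moreover have "l * l ^ j dvd - l * f ((s - 1) * X ^ Suc i)"
      unfolding mult_minus_left dvd_minus_iff by (intro mult_dvd_mono dvd_refl Suc)
    ultimately have "l ^ Suc j dvd int p * f ((s - 1) * X ^ i)" by simp
    moreover have "coprime (l ^ Suc j) (int p)" using l(2) coprime_power_left_iff by blast
    ultimately show ?case using coprime_dvd_mult_right_iff by blast
  qed simp
  note dvd = this[where i = 0, simplified]
  have "f (s - 1) = 0" if f: "f \<in> F" for f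
  proof (rule ccontr)
    assume nz: "f (s - 1) \<noteq> 0"
    define j where "j = nat \<bar>f (s - 1)\<bar>"
    have "l ^ j \<le> \<bar>f (s - 1)\<bar>" using dvd[OF f, of j] nz by (intro zdvd_imp_le) auto
    moreover have "int j < 2 ^ j" by simp
    moreover have "(2::int) ^ j \<le> l ^ j" using l by (intro power_mono) auto
    ultimately show False by (simp add: j_def)
  qed
  then have "s - 1 = 0" using F_inj s(1) unfolding one_plus_def by blast
  then show ?thesis by simp
qed

text \<open>For a prime p dividing \<open>k = q * p\<close>, the power \<open>s ^ q\<close> is again
  near 1 and has p-th power 1; the prime case makes it 1, and the exponent drops from
  \<open>k\<close> to \<open>q\<close>.\<close>

lemma mcong_one_torsion:
  assumes "s \<in> one_plus" "mcong 6 s 1" "0 < k" "s ^ k = 1"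
  shows "s = 1"
  using assms(3,4)
proof (induction k rule: less_induct)
  case (less k)
  show ?case
  proof (cases "k = 1")
    case False
    then obtain p where p: "prime p" "p dvd k" using prime_factor_nat by blast
    then obtain q where q: "k = q * p" by (metis dvd_def mult.commute)
    have "mcong 6 (s ^ q) 1" using mcong_power[OF assms(2) assms(1) one_one_plus, of q] by simp
    then have "s ^ q = 1"
      using mcong_one_prime_torsion[of "s ^ q" p] power_one_plus assms(1) p less.prems q
      by (simp add: power_mult)
    moreover have "q < k" "0 < q" using p less.prems q prime_gt_1_nat by auto
    ultimately show ?thesis using less.IH by blast
  qed (use less.prems in simp)
qed

end

section \<open>The annihilator filtration attached to a normal subgroup\<close>

locale unipotent_normal = lattice_ring S F
  for S :: "'r::ring_1 set" and F :: "('r \<Rightarrow> int) set" +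
  fixes \<Gamma> U :: "'r set" and D :: nat
  assumes G_one_plus: "\<Gamma> \<subseteq> one_plus"
    and mult_G: "g \<in> \<Gamma> \<Longrightarrow> h \<in> \<Gamma> \<Longrightarrow> g * h \<in> \<Gamma>"
    and one_U: "1 \<in> U"
    and inv_G: "g \<in> \<Gamma> \<Longrightarrow> \<exists>h\<in>\<Gamma>. g * h = 1 \<and> h * g = 1"
    and U_G: "U \<subseteq> \<Gamma>"
    and mult_U: "u \<in> U \<Longrightarrow> v \<in> U \<Longrightarrow> u * v \<in> U"
    and inv_U: "u \<in> U \<Longrightarrow> \<exists>v\<in>U. u * v = 1 \<and> v * u = 1"
    and normal_U: "u \<in> U \<Longrightarrow> g \<in> \<Gamma> \<Longrightarrow> h \<in> \<Gamma> \<Longrightarrow> g * h = 1 \<Longrightarrow> g * u * h \<in> U"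
    and D_pos: "0 < D"
    and power_D: "g \<in> \<Gamma> \<Longrightarrow> g ^ D \<in> U"
    and exponent: "0 < m \<Longrightarrow> \<exists>N>0. \<forall>g\<in>\<Gamma>. mcong m (g ^ N) 1"
begin

text \<open>\<open>J k\<close> consists of the elements of \<open>S\<close> that are annihilated by
  right multiplication with every product of \<open>k\<close> factors \<open>u - 1\<close>, where
  \<open>u \<in> U\<close>. The conditions \<open>u - 1 \<in> J k\<close> filter \<open>U\<close>;
  unipotence will be used in the form that \<open>u - 1 \<in> J n\<close> for all
  \<open>u \<in> U\<close>.\<close>

primrec J :: "nat \<Rightarrow> 'r set" where
  "J 0 = {0}"
| "J (Suc k) = {a \<in> S. \<forall>u\<in>U. a * (u - 1) \<in> J k}"

lemma power_G: "g \<in> \<Gamma> \<Longrightarrow> g ^ k \<in> \<Gamma>"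
  using one_U U_G by (induction k) (auto intro: mult_G)

lemma power_U: "g \<in> U \<Longrightarrow> g ^ k \<in> U"
  using one_U by (induction k) (auto intro: mult_U)

lemma J_S: "a \<in> J k \<Longrightarrow> a \<in> S"
  by (cases k) (auto simp: zero_S)

lemma J_zero: "0 \<in> J k"
  by (induction k) (auto simp: zero_S)

lemma J_add: "a \<in> J k \<Longrightarrow> b \<in> J k \<Longrightarrow> a + b \<in> J k"
  by (induction k arbitrary: a b) (auto simp: add_S distrib_right)

lemma J_uminus: "a \<in> J k \<Longrightarrow> - a \<in> J k"
  by (induction k arbitrary: a) (auto simp: uminus_S simp flip: minus_mult_left)

lemma J_diff: "a \<in> J k \<Longrightarrow> b \<in> J k \<Longrightarrow> a - b \<in> J k"
  using J_add[of a k "- b"] J_uminus by simp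

lemma J_of_int: "a \<in> J k \<Longrightarrow> of_int m * a \<in> J k"
  by (induction k arbitrary: a) (auto simp: of_int_S mult.assoc)

lemma J_mult_left: "a \<in> J k \<Longrightarrow> g \<in> one_plus \<Longrightarrow> g * a \<in> J k"
  by (induction k arbitrary: a) (auto simp: mult_one_plus_left mult.assoc)

text \<open>Normality of \<open>U\<close> enters here: if \<open>h\<close> is the inverse of
  \<open>g\<close>, then \<open>a * g * (u - 1) = a * (g * u * h - 1) * g\<close> with
  \<open>g * u * h \<in> U\<close>.\<close>

lemma J_mult_right: "a \<in> J k \<Longrightarrow> g \<in> \<Gamma> \<Longrightarrow> a * g \<in> J k"
proof (induction k arbitrary: a)
  case (Suc k)
  obtain h where h: "h \<in> \<Gamma>" "g * h = 1" "h * g = 1" using inv_G Suc.prems by blast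
  have "a * g * (u - 1) \<in> J k" if u: "u \<in> U" for u
  proof -
    have "a * g * (u - 1) = a * (g * u * h - 1) * g"
      using h by (simp add: algebra_simps mult.assoc)
    moreover have "g * u * h \<in> U" using normal_U u h Suc.prems by blast
    ultimately show ?thesis using Suc by auto
  qed
  then show ?case using Suc.prems mult_one_plus_right G_one_plus by auto
qed simp

text \<open>\<open>S\<close> modulo \<open>J k\<close> has no torsion, which permits division by
  integers modulo \<open>J k\<close>. This is inherited from \<open>S\<close>, as integer multiples
  commute with right multiplication by \<open>u - 1\<close>.\<close>

lemma J_pure: "of_int m * a \<in> J k \<Longrightarrow> m \<noteq> 0 \<Longrightarrow> a \<in> S \<Longrightarrow> a \<in> J k"
proof (induction k arbitrary: a)
  case 0
  then show ?case using torsion_free_S by auto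
next
  case (Suc k)
  have "a * (u - 1) \<in> J k" if u: "u \<in> U" for u
  proof (rule Suc.IH)
    show "of_int m * (a * (u - 1)) \<in> J k" using Suc.prems u by (simp add: mult.assoc)
    show "a * (u - 1) \<in> S" using Suc.prems u U_G G_one_plus one_plus_def mult_S by auto
  qed (use Suc.prems in simp)
  then show ?case using Suc.prems by simp
qed

text \<open>\<open>J k\<close> need not be an ideal, but it is stable under left multiplication by
  \<open>one_plus\<close> and right multiplication by \<Gamma>. This suffices for calculating with
  elements that commute modulo \<open>J k\<close>.\<close>

lemma J_commute_power:
  assumes "x \<in> \<Gamma>" "w \<in> \<Gamma>" "x * w - w * x \<in> J k"
  shows "x * w ^ m - w ^ m * x \<in> J k"
proof (induction m)
  case 0
  show ?case using J_zero by simp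
next
  case (Suc m)
  have "x * w ^ Suc m - w ^ Suc m * x = (x * w ^ m - w ^ m * x) * w + w ^ m * (x * w - w * x)"
    by (simp add: algebra_simps power_Suc2 del: power_Suc)
  then show ?case using J_add J_mult_right[OF Suc] J_mult_left[OF assms(3)] assms power_one_plus G_one_plus
    by (metis subsetD)
qed

lemma J_power_mult:
  assumes "x \<in> \<Gamma>" "w \<in> \<Gamma>" "x * w - w * x \<in> J k"
  shows "(x * w) ^ m - x ^ m * w ^ m \<in> J k"
proof (induction m)
  case 0
  show ?case using J_zero by simp
next
  case (Suc m)
  have "(x * w) ^ Suc m - x ^ Suc m * w ^ Suc m
      = ((x * w) ^ m - x ^ m * w ^ m) * (x * w) - x ^ m * ((x * w ^ m - w ^ m * x) * w)"
    by (simp add: algebra_simps power_Suc2 del: power_Suc)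
  moreover have "((x * w) ^ m - x ^ m * w ^ m) * (x * w) \<in> J k"
    using J_mult_right[OF Suc] assms mult_G by blast
  moreover have "x ^ m * ((x * w ^ m - w ^ m * x) * w) \<in> J k"
    using J_mult_left J_mult_right J_commute_power[OF assms] assms power_one_plus G_one_plus by blast
  ultimately show ?case using J_diff by simp
qed

text \<open>On this layer \<open>v - 1\<close> behaves like a logarithm: products become sums modulo
  \<open>J k\<close>.\<close>

lemma J_unit_mult:
  assumes "v \<in> U" "w \<in> U" "v - 1 \<in> J (Suc k)" "w - 1 \<in> J (Suc k)"
  shows "v * w - 1 \<in> J (Suc k)" "v * w - 1 - (v - 1) - (w - 1) \<in> J k"
proof -
  have "v * w - 1 = (v - 1) * w + (w - 1)" by (simp add: algebra_simps)
  then show "v * w - 1 \<in> J (Suc k)"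
    using J_add J_mult_right[OF assms(3)] assms U_G by (metis subsetD)
  have "v * w - 1 - (v - 1) - (w - 1) = (v - 1) * (w - 1)" by (simp add: algebra_simps)
  then show "v * w - 1 - (v - 1) - (w - 1) \<in> J k" using assms by simp
qed

lemma J_unit_power:
  assumes "v \<in> U" "v - 1 \<in> J (Suc k)"
  shows "v ^ m - 1 \<in> J (Suc k) \<and> v ^ m - 1 - of_nat m * (v - 1) \<in> J k"
proof (induction m)
  case 0
  show ?case using J_zero[of k] J_zero[of "Suc k"] by simp
next
  case (Suc m)
  note * = J_unit_mult[OF power_U[OF assms(1), of m] assms(1) _ assms(2)]
  have "v ^ Suc m - 1 - of_nat (Suc m) * (v - 1)
      = (v ^ m * v - 1 - (v ^ m - 1) - (v - 1)) + (v ^ m - 1 - of_nat m * (v - 1))"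
    by (simp add: algebra_simps power_commutes)
  moreover have "\<dots> \<in> J k" using J_add * Suc by blast
  moreover have "v ^ Suc m = v ^ m * v" by (simp add: power_commutes)
  ultimately show ?case using * Suc by metis
qed

lemma J_unit_inverse:
  assumes "v \<in> U" "w \<in> U" "v * w = 1" "v - 1 \<in> J (Suc k)"
  shows "w - 1 \<in> J (Suc k)" "w - 1 + (v - 1) \<in> J k"
proof -
  have "w - 1 = - ((v - 1) * w)" using assms by (simp add: algebra_simps)
  then show *: "w - 1 \<in> J (Suc k)"
    using J_uminus J_mult_right[OF assms(4)] assms U_G by (metis subsetD)
  show "w - 1 + (v - 1) \<in> J k"
    using J_uminus[OF J_unit_mult(2)[OF assms(1,2,4) *]] assms(3) by (simp add: algebra_simps)
qed

text \<open>The classes of \<open>v - 1\<close> for \<open>v \<in> U\<close> with \<open>v - 1 \<in> J (Suc k)\<close> form an additive group modulo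
  \<open>J k\<close>, because \<open>(v - 1) * (w - 1) \<in> J k\<close>.\<close>

lemma unit_divisible:
  assumes N: "0 < N"
  shows "\<exists>m>0. \<forall>y\<in>U. y - 1 \<in> J (Suc k) \<longrightarrow> mcong m y 1 \<longrightarrow>
    (\<exists>v\<in>U. v - 1 \<in> J (Suc k) \<and> y - 1 - of_int N * (v - 1) \<in> J k)"
proof -
  \<comment> \<open>Enlarging the set of these \<open>v - 1\<close> by \<open>J k\<close> gives a
    genuine additive subgroup of \<open>S\<close>, as \<open>additive_subgroup_divisible\<close>
    demands.\<close>
  define A where "A = {a \<in> S. \<exists>v\<in>U. v - 1 \<in> J (Suc k) \<and> a - (v - 1) \<in> J k}"
  have zero: "0 \<in> A" using zero_S one_U J_zero[of k] J_zero[of "Suc k"]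
    unfolding A_def by force
  have add: "a + b \<in> A" if "a \<in> A" "b \<in> A" for a b
  proof -
    from that obtain v w where vw: "v \<in> U" "w \<in> U" "v - 1 \<in> J (Suc k)" "w - 1 \<in> J (Suc k)"
      "a - (v - 1) \<in> J k" "b - (w - 1) \<in> J k" unfolding A_def by blast
    have "a + b - (v * w - 1) = (a - (v - 1)) + (b - (w - 1)) - (v * w - 1 - (v - 1) - (w - 1))"
      by simp
    also have "\<dots> \<in> J k" using J_add J_diff J_unit_mult(2)[OF vw(1-4)] vw by blast
    finally show ?thesis
      using that J_unit_mult(1)[OF vw(1-4)] mult_U[OF vw(1,2)] add_S unfolding A_def by blast
  qed
  have neg: "- a \<in> A" if "a \<in> A" for a
  proof -
    from that obtain v where v: "v \<in> U" "v - 1 \<in> J (Suc k)" "a - (v - 1) \<in> J k"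
      unfolding A_def by blast
    obtain w where w: "w \<in> U" "v * w = 1" using inv_U v by blast
    note * = J_unit_inverse[OF v(1) w v(2)]
    have "- a - (w - 1) = - (a - (v - 1)) - (w - 1 + (v - 1))" by simp
    also have "\<dots> \<in> J k" using J_diff J_uminus v * by blast
    finally show ?thesis using that * w uminus_S unfolding A_def by blast
  qed
  have mul: "of_int m * a \<in> A" if "a \<in> A" for m a
  proof (induction m rule: int_induct[where k = 0])
    case base
    show ?case using zero by simp
  next
    case (step1 i)
    then show ?case using add that by (simp add: algebra_simps)
  next
    case (step2 i)
    then show ?case using add[OF _ neg[OF that]] by (simp add: algebra_simps)
  qed
  have "\<exists>m>0. \<forall>a\<in>A. (\<forall>f\<in>F. m dvd f a) \<longrightarrow> (\<exists>b\<in>A. \<forall>f\<in>F. f a = N * f b)"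
    using finite_F F_add zero add mul N by (rule additive_subgroup_divisible)
  then obtain m where m: "m > 0"
    and div: "\<forall>a\<in>A. (\<forall>f\<in>F. m dvd f a) \<longrightarrow> (\<exists>b\<in>A. \<forall>f\<in>F. f a = N * f b)"
    by (elim exE conjE) (rule that)
  have "\<exists>v\<in>U. v - 1 \<in> J (Suc k) \<and> y - 1 - of_int N * (v - 1) \<in> J k"
    if y: "y \<in> U" "y - 1 \<in> J (Suc k)" "mcong m y 1" for y
  proof -
    have "y - 1 \<in> A" using y J_S J_zero[of k] unfolding A_def by force
    moreover have "\<forall>f\<in>F. m dvd f (y - 1)" using F_dvd_of_mcong y by blast
    ultimately obtain b where b: "b \<in> A" "\<And>f. f \<in> F \<Longrightarrow> f (y - 1) = N * f b"
      using div by blast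
    have "y - 1 - of_int N * b = 0"
    proof (rule F_inj)
      show "y - 1 - of_int N * b \<in> S" using diff_S of_int_S b J_S[OF y(2)] by (auto simp: A_def)
      show "\<forall>f\<in>F. f (y - 1 - of_int N * b) = 0"
      proof
        fix f assume f: "f \<in> F"
        show "f (y - 1 - of_int N * b) = 0"
          using b(2)[OF f] F_add[OF f, of "y - 1" "of_int (- N) * b"] F_mult[OF f, of "- N" b]
          by simp
      qed
    qed
    moreover from b obtain v where v: "v \<in> U" "v - 1 \<in> J (Suc k)" "b - (v - 1) \<in> J k"
      unfolding A_def by blast
    \<comment> \<open>The exact quotient \<open>b\<close> agrees with \<open>v - 1\<close> only
      modulo \<open>J k\<close>; the error stays in \<open>J k\<close> when multiplied by
      \<open>N\<close>.\<close>
    ultimately have "y - 1 - of_int N * (v - 1) = of_int N * (b - (v - 1))"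
      by (simp add: algebra_simps)
    then show ?thesis using J_of_int v by metis
  qed
  then show ?thesis using m by blast
qed

text \<open>This unrolls the recursion of \<open>J\<close>; vanishing products of factors
  \<open>u - 1\<close> are what unipotence of a matrix group provides.\<close>

lemma J_I:
  assumes "a \<in> S"
    and "\<And>us. length us = k \<Longrightarrow> set us \<subseteq> U \<Longrightarrow> a * prod_list (map (\<lambda>u. u - 1) us) = 0"
  shows "a \<in> J k"
  using assms
proof (induction k arbitrary: a)
  case 0
  show ?case using "0.prems"(2)[of "[]"] by simp
next
  case (Suc k)
  have "a * (u - 1) \<in> J k" if u: "u \<in> U" for u
  proof (rule Suc.IH)
    show "a * (u - 1) \<in> S" using mult_S Suc.prems(1) u U_G G_one_plus by (auto simp: one_plus_def)
    fix us :: "'r list"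
    assume "length us = k" "set us \<subseteq> U"
    then show "a * (u - 1) * prod_list (map (\<lambda>u. u - 1) us) = 0"
      using Suc.prems(2)[of "u # us"] u by (simp add: mult.assoc)
  qed
  then show ?case using Suc.prems(1) by simp
qed

text \<open>One step down the filtration: \<open>x ^ D\<close> is, modulo \<open>J k\<close>, the \<open>D\<close>-th power of an element
  \<open>v ^ N\<close> of \<open>U\<close> that is close to 1. Since \<open>J k\<close> is pure, \<open>v\<close> commutes with \<open>x\<close> modulo \<open>J k\<close>
  (as \<open>x ^ D\<close> does), so dividing \<open>x\<close> by \<open>v ^ N\<close> makes the \<open>D\<close>-th power trivial modulo \<open>J k\<close>.\<close>

lemma descent_step:
  assumes x: "x \<in> \<Gamma>" and v: "v \<in> U" "v - 1 \<in> J (Suc k)" and N: "0 < N"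
    and xv: "x ^ D - 1 - of_int (int (N * D)) * (v - 1) \<in> J k"
    and w: "w \<in> \<Gamma>" "v ^ N * w = 1" "w * v ^ N = 1"
  shows "(x * w) ^ D - 1 \<in> J k"
proof -
  have vG: "v \<in> \<Gamma>" using v U_G by blast
  obtain h where h: "h \<in> \<Gamma>" "x * h = 1" "h * x = 1" using inv_G x by blast
  define a where "a = x ^ D - 1 - of_int (int (N * D)) * (v - 1)"
  have a: "a \<in> J k" using xv by (simp add: a_def)
  \<comment> \<open>Conjugation by \<open>x\<close> fixes \<open>x ^ D\<close>, so comparing
    \<open>a\<close> with its conjugate leaves \<open>N * D\<close> times the change of
    \<open>v - 1\<close> under conjugation.\<close>
  have "x * x ^ D * h = x ^ D * (x * h)" by (metis power_commutes mult.assoc)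
  then have xD: "x * x ^ D * h = x ^ D" using h by simp
  have "x * a * h = x ^ D - 1 - of_int (int (N * D)) * (x * (v - 1) * h)"
  proof -
    have "x * a * h = x * x ^ D * h - x * h - x * (of_int (int (N * D)) * (v - 1)) * h"
      by (simp only: a_def right_diff_distrib left_diff_distrib mult_1_right mult.assoc)
    moreover have "x * (of_int (int (N * D)) * (v - 1)) * h
        = of_int (int (N * D)) * (x * (v - 1) * h)"
      by (metis mult.assoc mult_of_int_commute)
    ultimately show ?thesis using h xD by simp
  qed
  then have "a - x * a * h = of_int (int (N * D)) * (x * (v - 1) * h - (v - 1))"
    unfolding a_def by (simp add: right_diff_distrib)
  moreover have "a - x * a * h \<in> J k"
    by (intro J_diff J_mult_right J_mult_left a h(1) subsetD[OF G_one_plus x])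
  moreover have "x * (v - 1) * h - (v - 1) \<in> S"
  proof -
    have "x * (v - 1) * h \<in> J (Suc k)"
      by (intro J_mult_right J_mult_left v(2) h(1) subsetD[OF G_one_plus x])
    then show ?thesis using J_S J_diff[OF _ v(2)] by blast
  qed
  ultimately have "x * (v - 1) * h - (v - 1) \<in> J k"
    using J_pure N D_pos by (metis mult_pos_pos of_nat_0_less_iff less_irrefl)
  then have "(x * (v - 1) * h - (v - 1)) * x \<in> J k" using J_mult_right x by blast
  moreover have "(x * (v - 1) * h - (v - 1)) * x = x * v - v * x"
    using h by (simp add: algebra_simps)
  ultimately have "x * v ^ N - v ^ N * x \<in> J k" using J_commute_power x vG by simp
  \<comment> \<open>Multiplying by \<open>w\<close> on both sides transfers the commutation with
    \<open>x\<close> from \<open>v ^ N\<close> to its inverse \<open>w\<close>.\<close>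
  then have "w * (x * v ^ N - v ^ N * x) * w \<in> J k"
    using J_mult_left J_mult_right w G_one_plus by blast
  moreover have "w * (x * v ^ N - v ^ N * x) * w = w * x - x * w"
  proof -
    have "w * (x * v ^ N - v ^ N * x) * w = w * x * (v ^ N * w) - (w * v ^ N) * x * w"
      by (simp add: algebra_simps)
    then show ?thesis using w by simp
  qed
  ultimately have comm: "x * w - w * x \<in> J k" using J_uminus by fastforce
  \<comment> \<open>Both \<open>x ^ D\<close> and \<open>v ^ (N * D)\<close> equal
    \<open>1 + N * D * (v - 1)\<close> modulo \<open>J k\<close>.\<close>
  have vND: "v ^ (N * D) - 1 - of_int (int (N * D)) * (v - 1) \<in> J k"
    using J_unit_power[OF v, of "N * D"] by simp
  have "x ^ D - v ^ (N * D) = a - (v ^ (N * D) - 1 - of_int (int (N * D)) * (v - 1))"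
    unfolding a_def by simp
  then have "(x ^ D - v ^ (N * D)) * w ^ D \<in> J k"
    using J_diff[OF a vND] J_mult_right power_G w by metis
  moreover have "v ^ (N * D) * w ^ D = 1"
    using left_right_inverse_power w by (metis power_mult)
  ultimately have "x ^ D * w ^ D - 1 \<in> J k" by (simp add: left_diff_distrib)
  then show ?thesis using J_add[OF J_power_mult[OF x w(1) comm, of D]] by fastforce
qed

text \<open>Induction on the depth \<open>k\<close>: each step multiplies \<open>x\<close> by an
  element close to 1 so that the D-th power becomes trivial one level deeper. At depth 0 it is
  exactly 1, and \<open>x\<close> itself serves.\<close>

lemma root_of_one_near:
  assumes "0 < m"
  shows "\<exists>m'>0. \<forall>x\<in>\<Gamma>. x ^ D - 1 \<in> J k \<longrightarrow> mcong m' (x ^ D) 1 \<longrightarrow>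
    (\<exists>x'\<in>\<Gamma>. mcong m x' x \<and> x' ^ D = 1)"
  using assms
proof (induction k)
  case 0
  then show ?case using mcong_refl by (intro exI[of _ 1]) auto
next
  case (Suc k)
  obtain m1 where m1: "m1 > 0" and IH: "\<And>x. x \<in> \<Gamma> \<Longrightarrow> x ^ D - 1 \<in> J k \<Longrightarrow> mcong m1 (x ^ D) 1 \<Longrightarrow>
      \<exists>x'\<in>\<Gamma>. mcong m x' x \<and> x' ^ D = 1" using Suc by blast
  \<comment> \<open>\<open>v ^ N\<close> will be 1 modulo \<open>m1 * m\<close>: the factor
    \<open>m\<close> keeps the corrected element congruent to \<open>x\<close>, and
    \<open>m1\<close> keeps its D-th power within reach of the induction hypothesis.\<close>
  obtain N where N: "N > 0" and exp: "\<And>g. g \<in> \<Gamma> \<Longrightarrow> mcong (m1 * m) (g ^ N) 1"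
    using exponent[of "m1 * m"] m1 Suc.prems by auto
  \<comment> \<open>The divisor is \<open>N * D\<close> because \<open>x ^ D\<close> is to be
    matched by the D-th power of \<open>v ^ N\<close>.\<close>
  obtain m3 where m3: "m3 > 0" and div: "\<And>y. y \<in> U \<Longrightarrow> y - 1 \<in> J (Suc k) \<Longrightarrow> mcong m3 y 1 \<Longrightarrow>
      \<exists>v\<in>U. v - 1 \<in> J (Suc k) \<and> y - 1 - of_int (int (N * D)) * (v - 1) \<in> J k"
    using unit_divisible[of "int (N * D)" k] N D_pos by auto
  have "\<exists>x'\<in>\<Gamma>. mcong m x' x \<and> x' ^ D = 1"
    if x: "x \<in> \<Gamma>" "x ^ D - 1 \<in> J (Suc k)" "mcong (m3 * (m1 * m)) (x ^ D) 1" for x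
  proof -
    obtain v where v: "v \<in> U" "v - 1 \<in> J (Suc k)"
      "x ^ D - 1 - of_int (int (N * D)) * (v - 1) \<in> J k"
      using div[OF power_D[OF x(1)] x(2)] mcong_dvd[OF x(3)] by auto
    have vG: "v ^ N \<in> \<Gamma>" using v U_G power_G by blast
    then obtain w where w: "w \<in> \<Gamma>" "v ^ N * w = 1" "w * v ^ N = 1" using inv_G by blast
    have xw: "x * w \<in> \<Gamma>" using mult_G x w by blast
    have "mcong (m1 * m) (v ^ N * w) w"
      using mcong_mult_right[OF exp, of v w] v U_G w G_one_plus by auto
    then have "mcong (m1 * m) w 1" using mcong_sym w by simp
    then have near: "mcong (m1 * m) (x * w) x"
      using mcong_mult_left[of "m1 * m" w 1 x] x G_one_plus by auto
    then have "mcong (m1 * m) ((x * w) ^ D) (x ^ D)" using mcong_power xw x G_one_plus by blast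
    moreover have "mcong (m1 * m) (x ^ D) 1" using mcong_dvd[OF x(3)] by simp
    ultimately have "mcong m1 ((x * w) ^ D) 1" using mcong_trans mcong_dvd dvd_triv_left by blast
    then obtain x' where "x' \<in> \<Gamma>" "mcong m x' (x * w)" "x' ^ D = 1"
      using IH[OF xw descent_step[OF x(1) v(1,2) N v(3) w]] by blast
    then show ?thesis using mcong_trans mcong_dvd[OF near] by (meson dvd_triv_right)
  qed
  moreover have "m3 * (m1 * m) > 0" using m1 m3 Suc.prems by simp
  ultimately show ?case by blast
qed

text \<open>If \<open>t\<close> is near \<open>x\<close>, then \<open>x ^ D\<close> is near 1, so
  \<open>x\<close> is congruent modulo 6 to some \<open>x'\<close> in \<Gamma> with
  \<open>x' ^ D = 1\<close>. By \<open>tf\<close> this \<open>x'\<close> is 1, so \<open>t\<close>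
  is 1 modulo 6 and Minkowski's argument gives \<open>t = 1\<close>.\<close>

lemma torsion_near_torsion_free:
  assumes tf: "\<And>x. x \<in> \<Gamma> \<Longrightarrow> x ^ D = 1 \<Longrightarrow> x = 1" and nil: "\<And>u. u \<in> U \<Longrightarrow> u - 1 \<in> J n"
  shows "\<exists>m>0. \<forall>x\<in>\<Gamma>. \<forall>t\<in>one_plus. mcong m t x \<longrightarrow> t ^ D = 1 \<longrightarrow> t = 1"
proof -
  obtain m where m: "m > 0" and root: "\<And>x. x \<in> \<Gamma> \<Longrightarrow> x ^ D - 1 \<in> J n \<Longrightarrow> mcong m (x ^ D) 1 \<Longrightarrow>
      \<exists>x'\<in>\<Gamma>. mcong 6 x' x \<and> x' ^ D = 1" using root_of_one_near[of 6 n] by auto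
  have "t = 1" if x: "x \<in> \<Gamma>" and t: "t \<in> one_plus" "mcong (m * 6) t x" "t ^ D = 1" for x t
  proof -
    have "mcong m x t" "mcong 6 t x" using mcong_dvd[OF t(2)] mcong_sym by auto
    then have "mcong m (x ^ D) 1" using mcong_power[of m x t D] t x G_one_plus by auto
    then obtain x' where "x' \<in> \<Gamma>" "mcong 6 x' x" "x' ^ D = 1"
      using root[OF x nil[OF power_D[OF x]]] by blast
    then have "mcong 6 1 x" using tf by blast
    then have "mcong 6 t 1" using \<open>mcong 6 t x\<close> mcong_sym mcong_trans by blast
    then show ?thesis using mcong_one_torsion t D_pos by blast
  qed
  then show ?thesis using m by (intro exI[of _ "m * 6"]) auto
qed

end

subsection \<open>Integer matrices as endomorphisms\<close>

text \<open>Square integer matrices of all sizes live in one type of class \<^class>\<open>ring_1\<close>: an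
  \<open>n\<close> by \<open>n\<close> matrix acts on integer sequences through their first \<open>n\<close> entries.\<close>

typedef endo = "{f :: (nat \<Rightarrow> int) \<Rightarrow> nat \<Rightarrow> int. \<forall>x y. f (\<lambda>i. x i + y i) = (\<lambda>i. f x i + f y i)}"
  morphisms app Endo
  by (rule exI[of _ "\<lambda>v. v"]) simp

setup_lifting type_definition_endo

instantiation endo :: ring_1
begin

lift_definition zero_endo :: endo is "\<lambda>v i. 0" by simp
lift_definition one_endo :: endo is "\<lambda>v. v" by simp
lift_definition plus_endo :: "endo \<Rightarrow> endo \<Rightarrow> endo" is "\<lambda>f g v i. f v i + g v i"
  by (simp add: fun_eq_iff)
lift_definition uminus_endo :: "endo \<Rightarrow> endo" is "\<lambda>f v i. - f v i" by (simp add: fun_eq_iff)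
lift_definition minus_endo :: "endo \<Rightarrow> endo \<Rightarrow> endo" is "\<lambda>f g v i. f v i - g v i"
  by (simp add: fun_eq_iff)
lift_definition times_endo :: "endo \<Rightarrow> endo \<Rightarrow> endo" is "\<lambda>f g v. f (g v)" by simp

instance
proof
  show "(0 :: endo) \<noteq> 1"
    by transfer (auto simp: fun_eq_iff intro!: exI[of _ "\<lambda>_. 1"])
qed (transfer; simp add: fun_eq_iff algebra_simps)+

end

lift_definition mat_endo :: "nat \<Rightarrow> int mat \<Rightarrow> endo" is
  "\<lambda>n A v i. if i < n then \<Sum>j<n. A $$ (i, j) * v j else 0"
  by (auto simp: fun_eq_iff sum.distrib algebra_simps)

lemma mat_endo_add:
  assumes "A \<in> carrier_mat n n" "B \<in> carrier_mat n n"
  shows "mat_endo n (A + B) = mat_endo n A + mat_endo n B"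
  using assms by transfer (auto simp: fun_eq_iff sum.distrib algebra_simps)

lemma mat_endo_uminus:
  assumes "A \<in> carrier_mat n n"
  shows "mat_endo n (- A) = - mat_endo n A"
  using assms by transfer (auto simp: fun_eq_iff sum_negf)

lemma mat_endo_zero: "mat_endo n (0\<^sub>m n n) = 0"
  by transfer (auto simp: fun_eq_iff)

lemma mat_mult_entry:
  assumes "A \<in> carrier_mat n n" "B \<in> carrier_mat n n" "i < n" "j < n"
  shows "(A * B) $$ (i, j) = (\<Sum>k<n. A $$ (i, k) * B $$ (k, j))"
  using assms by (auto simp: scalar_prod_def lessThan_atLeast0)

lemma mat_endo_mult:
  assumes A: "A \<in> carrier_mat n n" and B: "B \<in> carrier_mat n n"
  shows "mat_endo n (A * B) = mat_endo n A * mat_endo n B"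
  using assms
proof transfer
  fix n :: nat and A B :: "int mat"
  assume AB: "A \<in> carrier_mat n n" "B \<in> carrier_mat n n"
  note * = mat_mult_entry[OF AB]
  show "(\<lambda>v i. if i < n then \<Sum>j<n. (A * B) $$ (i, j) * v j else 0) =
      (\<lambda>v i. if i < n then \<Sum>j<n. A $$ (i, j) * (if j < n then \<Sum>k<n. B $$ (j, k) * v k else 0) else 0)"
  proof (intro ext)
    fix v :: "nat \<Rightarrow> int" and i
    have "(\<Sum>j<n. (A * B) $$ (i, j) * v j) =
        (\<Sum>j<n. A $$ (i, j) * (if j < n then \<Sum>k<n. B $$ (j, k) * v k else 0))" if i: "i < n"
    proof -
      have "(\<Sum>j<n. (A * B) $$ (i, j) * v j) = (\<Sum>j<n. \<Sum>k<n. A $$ (i, k) * B $$ (k, j) * v j)"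
        using * i by (simp add: sum_distrib_right)
      also have "\<dots> = (\<Sum>k<n. \<Sum>j<n. A $$ (i, k) * B $$ (k, j) * v j)" by (rule sum.swap)
      finally show ?thesis by (simp add: sum_distrib_left mult.assoc)
    qed
    then show "(if i < n then \<Sum>j<n. (A * B) $$ (i, j) * v j else 0) =
      (if i < n then \<Sum>j<n. A $$ (i, j) * (if j < n then \<Sum>k<n. B $$ (j, k) * v k else 0) else 0)"
      by auto
  qed
qed

lift_definition endo_coord :: "nat \<Rightarrow> nat \<Rightarrow> endo \<Rightarrow> int" is
  "\<lambda>i j f. f (\<lambda>k. if k = j then 1 else 0) i" .

lemma endo_coord_add: "endo_coord i j (a + b) = endo_coord i j a + endo_coord i j b"
  by transfer simp

lemma endo_coord_mat_endo:
  assumes "i < n" "j < n"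
  shows "endo_coord i j (mat_endo n A) = A $$ (i, j)"
proof -
  have "(\<Sum>k<n. A $$ (i, k) * (if k = j then 1 else 0)) = (\<Sum>k<n. if k = j then A $$ (i, k) else 0)"
    by (intro sum.cong) auto
  also have "\<dots> = A $$ (i, j)" using assms by (subst sum.delta) auto
  finally show ?thesis using assms by (simp add: endo_coord.rep_eq mat_endo.rep_eq)
qed

lemma mat_endo_inj:
  assumes "A \<in> carrier_mat n n" "B \<in> carrier_mat n n" "mat_endo n A = mat_endo n B"
  shows "A = B"
  using assms endo_coord_mat_endo by (intro eq_matI) (auto, metis)

definition mat_lattice :: "nat \<Rightarrow> endo set" where
  "mat_lattice n = mat_endo n ` carrier_mat n n"

definition mat_coords :: "nat \<Rightarrow> (endo \<Rightarrow> int) set" where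
  "mat_coords n = (\<lambda>(i, j). endo_coord i j) ` ({..<n} \<times> {..<n})"

lemma lattice_ring_mat: "lattice_ring (mat_lattice n) (mat_coords n)"
proof
  show "finite (mat_coords n)" by (simp add: mat_coords_def)
  show "f (a + b) = f a + f b" if "f \<in> mat_coords n" for f a b
    using that endo_coord_add by (auto simp: mat_coords_def)
  show "0 \<in> mat_lattice n"
    unfolding mat_lattice_def using mat_endo_zero by (metis image_eqI zero_carrier_mat)
  show "a + b \<in> mat_lattice n" if "a \<in> mat_lattice n" "b \<in> mat_lattice n" for a b
    using that unfolding mat_lattice_def by (auto simp flip: mat_endo_add)
  show "- a \<in> mat_lattice n" if "a \<in> mat_lattice n" for a
    using that unfolding mat_lattice_def by (auto simp flip: mat_endo_uminus)
  show "a * b \<in> mat_lattice n" if "a \<in> mat_lattice n" "b \<in> mat_lattice n" for a b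
    using that unfolding mat_lattice_def by (auto simp flip: mat_endo_mult)
  show "a = 0" if a: "a \<in> mat_lattice n" "\<forall>f\<in>mat_coords n. f a = 0" for a
  proof -
    obtain A where A: "A \<in> carrier_mat n n" "a = mat_endo n A"
      using a by (auto simp: mat_lattice_def)
    have "A $$ (i, j) = 0" if "i < n" "j < n" for i j
    proof -
      have "endo_coord i j \<in> mat_coords n" using that unfolding mat_coords_def by force
      then show ?thesis using a(2) A that endo_coord_mat_endo by metis
    qed
    then have "A = 0\<^sub>m n n" using A by (intro eq_matI) auto
    then show ?thesis using A mat_endo_zero by simp
  qed
qed

global_interpretation mat: lattice_ring "mat_lattice n" "mat_coords n" for n
  by (rule lattice_ring_mat)

text \<open>\<open>mat_endo n\<close> maps the identity matrix to a proper idempotent; \<open>unital n\<close> corrects this by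
  acting as the identity on the remaining entries.\<close>

definition unital :: "nat \<Rightarrow> int mat \<Rightarrow> endo" where
  "unital n A = mat_endo n A + (1 - mat_endo n (1\<^sub>m n))"

lemma mat_endo_diff:
  assumes "A \<in> carrier_mat n n" "B \<in> carrier_mat n n"
  shows "mat_endo n (A - B) = mat_endo n A - mat_endo n B"
proof -
  have "A - B = A + - B" using assms by auto
  then show ?thesis using assms mat_endo_add[of A n "- B"] mat_endo_uminus[of B n] by simp
qed

lemma unital_diff:
  assumes "A \<in> carrier_mat n n" "B \<in> carrier_mat n n"
  shows "unital n A - unital n B = mat_endo n (A - B)"
  using mat_endo_diff[OF assms] by (simp add: unital_def)

lemma unital_one: "unital n (1\<^sub>m n) = 1"
  by (simp add: unital_def)

text \<open>The image \<open>?e\<close> of the identity matrix is a two-sided unit for the embedded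
  matrices, so the idempotent \<open>1 - ?e\<close> annihilates them on both sides and the cross
  terms vanish.\<close>

lemma unital_mult:
  assumes "A \<in> carrier_mat n n" "B \<in> carrier_mat n n"
  shows "unital n (A * B) = unital n A * unital n B"
proof -
  let ?e = "mat_endo n (1\<^sub>m n)"
  have "mat_endo n A * ?e = mat_endo n A" "?e * mat_endo n B = mat_endo n B" "?e * ?e = ?e"
    using assms mat_endo_mult[of _ n "1\<^sub>m n"] mat_endo_mult[of "1\<^sub>m n" n] by auto
  then show ?thesis using assms by (simp add: unital_def mat_endo_mult algebra_simps)
qed

lemma unital_inj:
  "A \<in> carrier_mat n n \<Longrightarrow> B \<in> carrier_mat n n \<Longrightarrow> unital n A = unital n B \<Longrightarrow> A = B"
  using mat_endo_inj by (auto simp: unital_def)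

lemma unital_one_plus:
  assumes "A \<in> carrier_mat n n"
  shows "unital n A \<in> mat.one_plus n"
  unfolding mat.one_plus_def
  using unital_diff[OF assms, of "1\<^sub>m n"] assms minus_carrier_mat[OF one_carrier_mat, of A n]
  by (simp add: unital_one mat_lattice_def)

section \<open>Congruence subgroups of GL(n, Z)\<close>

lemma app_of_int_mult: "app (of_int m * a) v i = m * app a v i"
proof (induction m rule: int_induct[where k = 0])
  case base
  show ?case by (simp add: zero_endo.rep_eq)
next
  case (step1 k)
  then show ?case by (simp add: distrib_right plus_endo.rep_eq)
next
  case (step2 k)
  then show ?case by (simp add: left_diff_distrib minus_endo.rep_eq)
qed

lemma mcong_unitalI:
  assumes "A \<in> carrier_mat n n" "B \<in> carrier_mat n n"
    and "\<And>i j. i < n \<Longrightarrow> j < n \<Longrightarrow> A $$ (i, j) mod m = B $$ (i, j) mod m"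
  shows "mat.mcong n m (unital n A) (unital n B)"
proof -
  define C where "C = mat n n (\<lambda>ij. (A $$ ij - B $$ ij) div m)"
  have C: "(A - B) $$ (i, j) = m * C $$ (i, j)" if "i < n" "j < n" for i j
    using assms that mod_eq_dvd_iff[of "A $$ (i, j)" m "B $$ (i, j)"] by (simp add: C_def)
  have "mat_endo n (A - B) = of_int m * mat_endo n C"
    unfolding app_inject[symmetric] fun_eq_iff app_of_int_mult mat_endo.rep_eq
    using C by (simp add: sum_distrib_left mult.assoc)
  then show ?thesis unfolding mat.mcong_def unital_diff[OF assms(1,2)]
    by (auto simp: mat_lattice_def C_def)
qed

lemma carrier_GL_D: "A \<in> carrier (GL TYPE('a::comm_ring_1) n) \<Longrightarrow> A \<in> carrier_mat n n"
  unfolding carrier_GL by blast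

lemma unital_GL_mult:
  assumes "A \<in> carrier (GL TYPE(int) n)" "B \<in> carrier (GL TYPE(int) n)"
  shows "unital n (A \<otimes>\<^bsub>GL TYPE(int) n\<^esub> B) = unital n A * unital n B"
  using assms unital_mult carrier_GL_D unfolding mult_GL by blast

lemma unital_GL_inv:
  assumes "A \<in> carrier (GL TYPE(int) n)"
  shows "unital n A * unital n (inv\<^bsub>GL TYPE(int) n\<^esub> A) = 1"
    and "unital n (inv\<^bsub>GL TYPE(int) n\<^esub> A) * unital n A = 1"
proof -
  interpret group "GL TYPE(int) n" by (rule group_GL)
  show "unital n A * unital n (inv\<^bsub>GL TYPE(int) n\<^esub> A) = 1"
    "unital n (inv\<^bsub>GL TYPE(int) n\<^esub> A) * unital n A = 1"
    using assms by (simp_all add: unital_GL_mult[symmetric] one_GL unital_one)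
qed

lemma unital_GL_power:
  assumes "A \<in> carrier (GL TYPE(int) n)"
  shows "unital n (A [^]\<^bsub>GL TYPE(int) n\<^esub> (k::nat)) = unital n A ^ k"
proof -
  interpret group "GL TYPE(int) n" by (rule group_GL)
  show ?thesis
    by (induction k) (use assms in \<open>simp_all add: unital_GL_mult one_GL unital_one power_commutes\<close>)
qed

text \<open>\<open>L\<close> contains the principal congruence subgroup of level \<open>m\<close>,
  so a coset is determined by the entries of a representative modulo \<open>m\<close>.\<close>

lemma finite_index_congruence_hull:
  assumes L: "subgroup L (GL TYPE(int) n)" and m: "0 < m"
    and near: "\<And>A. A \<in> carrier (GL TYPE(int) n) \<Longrightarrow> mat.mcong n m (unital n A) 1 \<Longrightarrow> A \<in> L"
  shows "finite_index_subgroup L (GL TYPE(int) n)"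
proof -
  interpret group "GL TYPE(int) n" by (rule group_GL)
  \<comment> \<open>Restricting to indices below \<open>n\<close> leaves functions with finite
    domain and finite range.\<close>
  let ?f = "\<lambda>A :: int mat. restrict (\<lambda>ij. A $$ ij mod m) ({..<n} \<times> {..<n})"
  have "?f ` carrier (GL TYPE(int) n) \<subseteq> PiE ({..<n} \<times> {..<n}) (\<lambda>_. {0..<m})"
    by (intro image_subsetI) (subst restrict_PiE_iff, use m in auto)
  then have fin: "finite (?f ` carrier (GL TYPE(int) n))"
    by (rule finite_subset) (auto intro: finite_PiE)
  have "finite (rcosets\<^bsub>GL TYPE(int) n\<^esub> L)"
  proof (rule finite_rcosetsI[OF L fin])
    fix A B assume A: "A \<in> carrier (GL TYPE(int) n)" and B: "B \<in> carrier (GL TYPE(int) n)"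
      and eq: "?f A = ?f B"
    have "A $$ (i, j) mod m = B $$ (i, j) mod m" if "i < n" "j < n" for i j
      using fun_cong[OF eq, of "(i, j)"] that by simp
    then have "mat.mcong n m (unital n A) (unital n B)"
      using mcong_unitalI A B carrier_GL_D by blast
    then have "mat.mcong n m (unital n A * unital n (inv\<^bsub>GL TYPE(int) n\<^esub> B))
        (unital n B * unital n (inv\<^bsub>GL TYPE(int) n\<^esub> B))"
      using mat.mcong_mult_right unital_one_plus carrier_GL_D inv_closed B by blast
    then show "A \<otimes>\<^bsub>GL TYPE(int) n\<^esub> inv\<^bsub>GL TYPE(int) n\<^esub> B \<in> L"
      using A B by (intro near) (simp_all add: unital_GL_mult unital_GL_inv)
  qed
  then show ?thesis using L by (simp add: finite_index_subgroup_def)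
qed

text \<open>The set is the product of \<open>H\<close> with the principal congruence subgroup of
  level \<open>m\<close>, that is, the preimage of the reduction of \<open>H\<close> modulo
  \<open>m\<close>.\<close>

lemma congruence_hull_subgroup:
  assumes H: "subgroup H (GL TYPE(int) n)"
  shows "subgroup {A \<in> carrier (GL TYPE(int) n). \<exists>B\<in>H. mat.mcong n m (unital n A) (unital n B)}
    (GL TYPE(int) n)" (is "subgroup ?L _")
proof -
  interpret group "GL TYPE(int) n" by (rule group_GL)
  note HG = subgroup.mem_carrier[OF H]
  note M = unital_one_plus[OF carrier_GL_D]
  show ?thesis
  proof (rule subgroupI)
    show "?L \<subseteq> carrier (GL TYPE(int) n)" by blast
    show "?L \<noteq> {}" using subgroup.one_closed[OF H] mat.mcong_refl by blast
    fix A assume "A \<in> ?L"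
    then obtain B where A: "A \<in> carrier (GL TYPE(int) n)" and B: "B \<in> H"
      "mat.mcong n m (unital n A) (unital n B)" by blast
    let ?A = "unital n (inv\<^bsub>GL TYPE(int) n\<^esub> A)" and ?B = "unital n (inv\<^bsub>GL TYPE(int) n\<^esub> B)"
    \<comment> \<open>The inverse of \<open>A\<close> on the left and that of \<open>B\<close> on
      the right turn the congruence of \<open>A\<close> and \<open>B\<close> into one of their
      inverses.\<close>
    have "mat.mcong n m (?A * (unital n A * ?B)) (?A * (unital n B * ?B))"
      using B HG A by (intro mat.mcong_mult_left mat.mcong_mult_right M inv_closed) auto
    moreover have "?A * (unital n A * ?B) = ?B"
      using unital_GL_inv[OF A] by (simp flip: mult.assoc)
    moreover have "?A * (unital n B * ?B) = ?A" using unital_GL_inv HG B by simp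
    ultimately have "mat.mcong n m ?A ?B" using mat.mcong_sym by simp
    then show "inv\<^bsub>GL TYPE(int) n\<^esub> A \<in> ?L" using A B subgroup.m_inv_closed[OF H] by blast
    fix A' assume "A' \<in> ?L"
    then obtain B' where A': "A' \<in> carrier (GL TYPE(int) n)" and B': "B' \<in> H"
      "mat.mcong n m (unital n A') (unital n B')" by blast
    have "mat.mcong n m (unital n A * unital n A') (unital n B * unital n B')"
      using A' B HG B' by (intro mat.mcong_mult M) auto
    then have "mat.mcong n m (unital n (A \<otimes>\<^bsub>GL TYPE(int) n\<^esub> A'))
        (unital n (B \<otimes>\<^bsub>GL TYPE(int) n\<^esub> B'))"
      using A A' B B' HG by (simp add: unital_GL_mult)
    then show "A \<otimes>\<^bsub>GL TYPE(int) n\<^esub> A' \<in> ?L"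
      using A A' B B' subgroup.m_closed[OF H] by blast
  qed
qed

text \<open>The congruence hull of the trivial group is the principal congruence subgroup of level
  \<open>m\<close>; its finite index yields a common exponent.\<close>

lemma GL_int_exponent_mod:
  assumes "0 < m"
  shows "\<exists>N>0. \<forall>A\<in>carrier (GL TYPE(int) n). mat.mcong n m (unital n A ^ N) 1"
proof -
  interpret group "GL TYPE(int) n" by (rule group_GL)
  let ?L = "{A \<in> carrier (GL TYPE(int) n).
    \<exists>B\<in>{\<one>\<^bsub>GL TYPE(int) n\<^esub>}. mat.mcong n m (unital n A) (unital n B)}"
  have "finite_index_subgroup ?L (GL TYPE(int) n)"
    using assms
    by (rule finite_index_congruence_hull[OF congruence_hull_subgroup[OF triv_subgroup]])
      (simp add: one_GL unital_one)
  then obtain N where "N > 0" "\<forall>A\<in>carrier (GL TYPE(int) n). A [^]\<^bsub>GL TYPE(int) n\<^esub> (N::nat) \<in> ?L"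
    using finite_index_exponent unfolding finite_index_subgroup_def by blast
  then show ?thesis by (auto simp: one_GL unital_one unital_GL_power)
qed

subsection \<open>Unipotent groups\<close>

definition unipotent_prod :: "nat \<Rightarrow> 'a::comm_ring_1 mat list \<Rightarrow> 'a mat" where
  "unipotent_prod n us = foldr (\<lambda>u X. (u - 1\<^sub>m n) * X) us (1\<^sub>m n)"

lemma unipotent_prod_carrier:
  "set us \<subseteq> carrier_mat n n \<Longrightarrow> unipotent_prod n us \<in> carrier_mat n n"
  by (induction us) (auto simp: unipotent_prod_def)

lemma unipotent_prod_Cons: "unipotent_prod n (u # us) = (u - 1\<^sub>m n) * unipotent_prod n us"
  by (simp add: unipotent_prod_def)

lemma conj_mult:
  fixes P Q X Y :: "'a::comm_ring_1 mat"
  assumes "P \<in> carrier_mat n n" "Q \<in> carrier_mat n n" "X \<in> carrier_mat n n" "Y \<in> carrier_mat n n"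
    and QP: "Q * P = 1\<^sub>m n"
  shows "P * (X * Y) * Q = (P * X * Q) * (P * Y * Q)"
proof -
  have "(P * X * Q) * (P * Y * Q) = P * X * ((Q * P) * (Y * Q))"
    using assms(1-4) by (simp add: assoc_mult_mat[of _ n n _ n _ n])
  also have "\<dots> = P * (X * Y) * Q"
    using assms by (simp add: QP assoc_mult_mat[of _ n n _ n _ n])
  finally show ?thesis by simp
qed

text \<open>After conjugation every factor \<open>u - 1\<close> is strictly upper triangular, and
  each such factor moves the first possibly nonzero diagonal up by one.\<close>

lemma unipotent_prod_conj_entry:
  fixes P Q :: "'a::comm_ring_1 mat"
  assumes PQ: "P \<in> carrier_mat n n" "Q \<in> carrier_mat n n" "P * Q = 1\<^sub>m n" "Q * P = 1\<^sub>m n"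
    and us: "set us \<subseteq> carrier_mat n n" "\<And>u. u \<in> set us \<Longrightarrow> P * u * Q \<in> upper_unitriangular TYPE('a) n"
    and ij: "i < n" "j < n" "j < i + length us"
  shows "(P * unipotent_prod n us * Q) $$ (i, j) = 0"
  using us ij
proof (induction us arbitrary: i)
  case Nil
  then show ?case using PQ by (simp add: unipotent_prod_def)
next
  case (Cons u us)
  let ?X = "unipotent_prod n us"
  let ?T = "P * (u - 1\<^sub>m n) * Q" and ?Y = "P * ?X * Q"
  have u: "u \<in> carrier_mat n n" and X: "?X \<in> carrier_mat n n"
    using Cons.prems unipotent_prod_carrier[of us n] by auto
  have T: "?T = P * u * Q - 1\<^sub>m n"
    using PQ u by (simp add: mult_minus_distrib_mat[of _ n n] minus_mult_distrib_mat[of _ n n])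
  have TY: "?T \<in> carrier_mat n n" "?Y \<in> carrier_mat n n" using PQ u X by auto
  have "P * unipotent_prod n (u # us) * Q = ?T * ?Y"
    unfolding unipotent_prod_Cons by (rule conj_mult) (use PQ u X in auto)
  then have "(P * unipotent_prod n (u # us) * Q) $$ (i, j) = (\<Sum>k<n. ?T $$ (i, k) * ?Y $$ (k, j))"
    using mat_mult_entry[OF TY Cons.prems(3,4)] by simp
  also have "\<dots> = 0"
  proof (rule sum.neutral, intro ballI)
    fix k assume k: "k \<in> {..<n}"
    show "?T $$ (i, k) * ?Y $$ (k, j) = 0"
    \<comment> \<open>On and below the diagonal the first factor vanishes. Otherwise
      \<open>k\<close> is at least \<open>i + 1\<close>, which makes up for the lost factor in the
      bound \<open>j < k + length us\<close>.\<close>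
    proof (cases "k \<le> i")
      case True
      have "P * u * Q \<in> upper_unitriangular TYPE('a) n" using Cons.prems by simp
      then have "?T $$ (i, k) = 0"
        unfolding T upper_unitriangular_def upper_triangular_def using True k Cons.prems
        by (cases "k = i") auto
      then show ?thesis by simp
    next
      case False
      then have "?Y $$ (k, j) = 0" using Cons k by auto
      then show ?thesis by simp
    qed
  qed
  finally show ?case .
qed

text \<open>With \<open>n\<close> factors the bound \<open>j < i + n\<close> covers every entry, and
  conjugating back preserves zero.\<close>

lemma unipotent_prod_eq_0:
  fixes P Q :: "'a::comm_ring_1 mat"
  assumes PQ: "P \<in> carrier_mat n n" "Q \<in> carrier_mat n n" "P * Q = 1\<^sub>m n" "Q * P = 1\<^sub>m n"
    and us: "set us \<subseteq> carrier_mat n n" "\<And>u. u \<in> set us \<Longrightarrow> P * u * Q \<in> upper_unitriangular TYPE('a) n"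
    and len: "length us = n"
  shows "unipotent_prod n us = 0\<^sub>m n n"
proof -
  let ?X = "unipotent_prod n us"
  have X: "?X \<in> carrier_mat n n" using unipotent_prod_carrier us by blast
  have "P * ?X * Q = 0\<^sub>m n n"
    using unipotent_prod_conj_entry[OF PQ us] len PQ X by (intro eq_matI) auto
  then have "Q * (P * ?X * Q) * P = 0\<^sub>m n n" using PQ by simp
  moreover have "Q * (P * ?X * Q) * P = (Q * P) * ?X * (Q * P)"
    using PQ(1,2) X by (simp add: assoc_mult_mat[of _ n n _ n _ n])
  ultimately show ?thesis using PQ X by simp
qed

lemma complexify_unipotent_prod:
  "set us \<subseteq> carrier_mat n n \<Longrightarrow>
    complexify (unipotent_prod n us) = unipotent_prod n (map complexify us)"
proof (induction us)
  case Nil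
  show ?case by (simp add: unipotent_prod_def complexify_def of_int_hom.mat_hom_one)
next
  case (Cons u us)
  have u: "u \<in> carrier_mat n n" using Cons.prems by simp
  have "unipotent_prod n us \<in> carrier_mat n n" using unipotent_prod_carrier Cons.prems by auto
  then have "complexify ((u - 1\<^sub>m n) * unipotent_prod n us)
      = complexify (u - 1\<^sub>m n) * complexify (unipotent_prod n us)"
    unfolding complexify_def using u by (intro of_int_hom.mat_hom_mult) auto
  moreover have "complexify (u - 1\<^sub>m n) = complexify u - 1\<^sub>m n"
    using u by (intro eq_matI) (auto simp: complexify_def)
  ultimately show ?case using Cons by (simp add: unipotent_prod_def)
qed

text \<open>The triangularizing matrix \<open>P\<close> is only complex, so the product is shown to
  vanish over the complex numbers and the result is pulled back along the injective
  \<open>complexify\<close>.\<close>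

lemma unipotent_prod_int_eq_0:
  assumes P: "P \<in> carrier (GL TYPE(complex) n)"
    and us: "set us \<subseteq> carrier_mat n n" "length us = n"
    and uni: "\<And>u. u \<in> set us \<Longrightarrow>
      P \<otimes>\<^bsub>GL TYPE(complex) n\<^esub> complexify u \<otimes>\<^bsub>GL TYPE(complex) n\<^esub> inv\<^bsub>GL TYPE(complex) n\<^esub> P
        \<in> upper_unitriangular TYPE(complex) n"
  shows "unipotent_prod n us = 0\<^sub>m n n"
proof -
  interpret group "GL TYPE(complex) n" by (rule group_GL)
  let ?Q = "inv\<^bsub>GL TYPE(complex) n\<^esub> P"
  have Q: "P \<in> carrier_mat n n" "?Q \<in> carrier_mat n n" "P * ?Q = 1\<^sub>m n" "?Q * P = 1\<^sub>m n"
    using P r_inv[OF P] l_inv[OF P] inv_closed[OF P] carrier_GL_D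
    by (auto simp: mult_GL one_GL)
  have "unipotent_prod n (map complexify us) = 0\<^sub>m n n"
    by (rule unipotent_prod_eq_0[OF Q]) (use us uni in \<open>auto simp: mult_GL complexify_def\<close>)
  then have "complexify (unipotent_prod n us) = 0\<^sub>m n n"
    using complexify_unipotent_prod us by metis
  then have "(complexify (unipotent_prod n us)) $$ (i, j) = 0" if "i < n" "j < n" for i j
    using that by simp
  then show ?thesis using unipotent_prod_carrier[OF us(1)]
    by (intro eq_matI) (auto simp: complexify_def)
qed

text \<open>The leading factor \<open>A\<close> matters for the empty list: the empty product of
  endomorphisms is 1, whereas the identity matrix maps to a proper idempotent, and
  \<open>mat_endo n A\<close> absorbs the difference.\<close>

lemma mat_endo_prod_list:
  assumes "A \<in> carrier_mat n n" "set us \<subseteq> carrier_mat n n"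
  shows "mat_endo n A * prod_list (map (\<lambda>u. u - 1) (map (unital n) us))
    = mat_endo n (A * unipotent_prod n us)"
  using assms
proof (induction us arbitrary: A)
  case Nil
  then show ?case by (simp add: unipotent_prod_def)
next
  case (Cons u us)
  have u: "u \<in> carrier_mat n n" "unital n u - 1 = mat_endo n (u - 1\<^sub>m n)"
    using Cons.prems unital_diff[of u n "1\<^sub>m n"] by (auto simp: unital_one)
  have "mat_endo n A * prod_list (map (\<lambda>u. u - 1) (map (unital n) (u # us)))
      = mat_endo n (A * (u - 1\<^sub>m n)) * prod_list (map (\<lambda>u. u - 1) (map (unital n) us))"
    using u Cons.prems mat_endo_mult[of A n "u - 1\<^sub>m n"] minus_carrier_mat[OF one_carrier_mat, of u n]
    by (simp flip: mult.assoc)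
  also have "\<dots> = mat_endo n (A * (u - 1\<^sub>m n) * unipotent_prod n us)"
    using u Cons.prems minus_carrier_mat[OF one_carrier_mat, of u n] by (intro Cons.IH) auto
  also have "A * (u - 1\<^sub>m n) * unipotent_prod n us = A * unipotent_prod n (u # us)"
    unfolding unipotent_prod_Cons
    by (rule assoc_mult_mat)
      (use u Cons.prems unipotent_prod_carrier[of us n] minus_carrier_mat[OF one_carrier_mat, of u n]
        in auto)
  finally show ?case .
qed

section \<open>The congruence hull of \<Gamma> and its torsion\<close>

theorem corollary1p2:
  fixes n :: nat and \<Gamma> :: "int mat set"
  assumes "subgroup \<Gamma> (GL TYPE(int) n)"
    and "torsion_free (GL TYPE(int) n) \<Gamma>"
    and "virtually_unipotent n (complexify ` \<Gamma>)"
  shows "\<exists>\<Lambda>\<^sub>0. finite_index_subgroup \<Lambda>\<^sub>0 (GL TYPE(int) n) \<and>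
              torsion_free (GL TYPE(int) n) \<Lambda>\<^sub>0 \<and>
              \<Gamma> \<subseteq> \<Lambda>\<^sub>0"
proof -
  let ?G = "GL TYPE(int) n" and ?C = "GL TYPE(complex) n"
  let ?H = "complexify ` \<Gamma>"
  interpret G: group ?G by (rule group_GL)
  interpret C: group ?C by (rule group_GL)
  interpret cx: group_hom ?G ?C complexify
    by unfold_locales (rule complexify_hom)
  note \<Gamma> = assms(1)
  note \<Gamma>G = subgroup.mem_carrier[OF \<Gamma>]
  note \<Gamma>_simps = \<Gamma>G subgroup.m_closed[OF \<Gamma>] subgroup.m_inv_closed[OF \<Gamma>] subgroup.one_closed[OF \<Gamma>]
  have \<Gamma>_pow: "g [^]\<^bsub>?G\<^esub> (k::nat) \<in> \<Gamma>" if "g \<in> \<Gamma>" for g k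
    using G.subgroup_nat_pow_closed[OF \<Gamma>] that by blast
  obtain V where V: "finite_index_subgroup V (?C\<lparr>carrier := ?H\<rparr>)" "unipotent_subgroup n V"
    and H: "subgroup ?H ?C"
    using assms(3) unfolding virtually_unipotent_def by blast
  then have VC: "subgroup V ?C" unfolding unipotent_subgroup_def by blast
  obtain P where P: "P \<in> carrier ?C" "\<And>g. g \<in> V \<Longrightarrow>
      P \<otimes>\<^bsub>?C\<^esub> g \<otimes>\<^bsub>?C\<^esub> inv\<^bsub>?C\<^esub> P \<in> upper_unitriangular TYPE(complex) n"
    using V(2) unfolding unipotent_subgroup_def by blast
  obtain N1 :: nat where N1: "N1 > 0" "\<And>h. h \<in> ?H \<Longrightarrow> h [^]\<^bsub>?C\<^esub> N1 \<in> V"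
  proof -
    interpret H: group "?C\<lparr>carrier := ?H\<rparr>" using H by (rule C.subgroup_imp_group)
    obtain N :: nat where "N > 0" "\<forall>h\<in>?H. h [^]\<^bsub>?C\<lparr>carrier := ?H\<rparr>\<^esub> N \<in> V"
      using H.finite_index_exponent V(1) unfolding finite_index_subgroup_def by auto
    then show ?thesis using that C.nat_pow_consistent by metis
  qed
  obtain N6 where N6: "N6 > 0" "\<And>A. A \<in> carrier ?G \<Longrightarrow> mat.mcong n 6 (unital n A ^ N6) 1"
    using GL_int_exponent_mod[of 6 n] by auto
  \<comment> \<open>The factor \<open>N1\<close> sends \<Gamma> into the group \<open>U\<close>
    below. The factor \<open>N6\<close> kills torsion: the \<open>N6\<close>-th power of a torsion
    matrix is torsion and 1 modulo 6, hence 1.\<close>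
  define D where "D = N1 * N6"
  \<comment> \<open>\<open>V\<close> need not be normal, so \<open>U\<close> is the normal core in
    \<Gamma> of its preimage.\<close>
  define U where "U = {g \<in> \<Gamma>. \<forall>x\<in>\<Gamma>. complexify (x \<otimes>\<^bsub>?G\<^esub> g \<otimes>\<^bsub>?G\<^esub> inv\<^bsub>?G\<^esub> x) \<in> V}"
  have U\<Gamma>: "U \<subseteq> \<Gamma>" unfolding U_def by blast
  have cV_mult: "complexify (a \<otimes>\<^bsub>?G\<^esub> b) \<in> V"
    if "complexify a \<in> V" "complexify b \<in> V" "a \<in> \<Gamma>" "b \<in> \<Gamma>" for a b
    using that subgroup.m_closed[OF VC] \<Gamma>G by simp
  have cV_inv: "complexify (inv\<^bsub>?G\<^esub> a) \<in> V" if "complexify a \<in> V" "a \<in> \<Gamma>" for a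
    using that subgroup.m_inv_closed[OF VC] \<Gamma>G by simp
  have conj_V: "complexify (x \<otimes>\<^bsub>?G\<^esub> g \<otimes>\<^bsub>?G\<^esub> inv\<^bsub>?G\<^esub> x) \<in> V
      \<and> x \<otimes>\<^bsub>?G\<^esub> g \<otimes>\<^bsub>?G\<^esub> inv\<^bsub>?G\<^esub> x \<in> \<Gamma>" if "g \<in> U" "x \<in> \<Gamma>" for g x
    using that subgroup.m_closed[OF \<Gamma>] subgroup.m_inv_closed[OF \<Gamma>] by (simp add: U_def)
  have U_one: "\<one>\<^bsub>?G\<^esub> \<in> U"
    using \<Gamma>_simps subgroup.one_closed[OF VC] by (simp add: U_def)
  have U_mult: "g \<otimes>\<^bsub>?G\<^esub> h \<in> U" if "g \<in> U" "h \<in> U" for g h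
  proof -
    have gh: "g \<in> \<Gamma>" "h \<in> \<Gamma>" using that U\<Gamma> by auto
    have "complexify (x \<otimes>\<^bsub>?G\<^esub> (g \<otimes>\<^bsub>?G\<^esub> h) \<otimes>\<^bsub>?G\<^esub> inv\<^bsub>?G\<^esub> x) \<in> V" if x: "x \<in> \<Gamma>" for x
    proof -
      have "x \<otimes>\<^bsub>?G\<^esub> (g \<otimes>\<^bsub>?G\<^esub> h) \<otimes>\<^bsub>?G\<^esub> inv\<^bsub>?G\<^esub> x
          = (x \<otimes>\<^bsub>?G\<^esub> g \<otimes>\<^bsub>?G\<^esub> inv\<^bsub>?G\<^esub> x) \<otimes>\<^bsub>?G\<^esub> (x \<otimes>\<^bsub>?G\<^esub> h \<otimes>\<^bsub>?G\<^esub> inv\<^bsub>?G\<^esub> x)"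
        using gh x \<Gamma>G by (simp add: G.m_assoc G.inv_solve_left)
      moreover have "complexify ((x \<otimes>\<^bsub>?G\<^esub> g \<otimes>\<^bsub>?G\<^esub> inv\<^bsub>?G\<^esub> x)
          \<otimes>\<^bsub>?G\<^esub> (x \<otimes>\<^bsub>?G\<^esub> h \<otimes>\<^bsub>?G\<^esub> inv\<^bsub>?G\<^esub> x)) \<in> V"
        by (rule cV_mult; use conj_V[OF \<open>g \<in> U\<close> x] conj_V[OF \<open>h \<in> U\<close> x] in blast)
      ultimately show ?thesis by metis
    qed
    then show ?thesis using gh \<Gamma>_simps by (simp add: U_def)
  qed
  have U_inv: "inv\<^bsub>?G\<^esub> g \<in> U" if "g \<in> U" for g
  proof -
    have g: "g \<in> \<Gamma>" using that U\<Gamma> by auto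
    have "complexify (x \<otimes>\<^bsub>?G\<^esub> inv\<^bsub>?G\<^esub> g \<otimes>\<^bsub>?G\<^esub> inv\<^bsub>?G\<^esub> x) \<in> V" if x: "x \<in> \<Gamma>" for x
    proof -
      have "x \<otimes>\<^bsub>?G\<^esub> inv\<^bsub>?G\<^esub> g \<otimes>\<^bsub>?G\<^esub> inv\<^bsub>?G\<^esub> x = inv\<^bsub>?G\<^esub> (x \<otimes>\<^bsub>?G\<^esub> g \<otimes>\<^bsub>?G\<^esub> inv\<^bsub>?G\<^esub> x)"
        using g x \<Gamma>G by (simp add: G.m_assoc G.inv_mult_group)
      moreover have "complexify (inv\<^bsub>?G\<^esub> (x \<otimes>\<^bsub>?G\<^esub> g \<otimes>\<^bsub>?G\<^esub> inv\<^bsub>?G\<^esub> x)) \<in> V"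
        by (rule cV_inv; use conj_V[OF \<open>g \<in> U\<close> x] in blast)
      ultimately show ?thesis by metis
    qed
    then show ?thesis using g \<Gamma>_simps by (simp add: U_def)
  qed
  have U_conj: "y \<otimes>\<^bsub>?G\<^esub> g \<otimes>\<^bsub>?G\<^esub> inv\<^bsub>?G\<^esub> y \<in> U" if "g \<in> U" and y: "y \<in> \<Gamma>" for g y
  proof -
    have g: "g \<in> \<Gamma>" using that U\<Gamma> by auto
    have "complexify (x \<otimes>\<^bsub>?G\<^esub> (y \<otimes>\<^bsub>?G\<^esub> g \<otimes>\<^bsub>?G\<^esub> inv\<^bsub>?G\<^esub> y) \<otimes>\<^bsub>?G\<^esub> inv\<^bsub>?G\<^esub> x) \<in> V" if x: "x \<in> \<Gamma>" for x
    proof -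
      have "x \<otimes>\<^bsub>?G\<^esub> (y \<otimes>\<^bsub>?G\<^esub> g \<otimes>\<^bsub>?G\<^esub> inv\<^bsub>?G\<^esub> y) \<otimes>\<^bsub>?G\<^esub> inv\<^bsub>?G\<^esub> x
          = (x \<otimes>\<^bsub>?G\<^esub> y) \<otimes>\<^bsub>?G\<^esub> g \<otimes>\<^bsub>?G\<^esub> inv\<^bsub>?G\<^esub> (x \<otimes>\<^bsub>?G\<^esub> y)"
        using g x y \<Gamma>G by (simp add: G.m_assoc G.inv_mult_group)
      moreover have "complexify ((x \<otimes>\<^bsub>?G\<^esub> y) \<otimes>\<^bsub>?G\<^esub> g \<otimes>\<^bsub>?G\<^esub> inv\<^bsub>?G\<^esub> (x \<otimes>\<^bsub>?G\<^esub> y)) \<in> V"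
        using conj_V[OF \<open>g \<in> U\<close>] x y subgroup.m_closed[OF \<Gamma>] by blast
      ultimately show ?thesis by metis
    qed
    then show ?thesis using g y \<Gamma>_simps by (simp add: U_def)
  qed
  have U_pow: "g [^]\<^bsub>?G\<^esub> D \<in> U" if g: "g \<in> \<Gamma>" for g
  proof -
    have "complexify (x \<otimes>\<^bsub>?G\<^esub> g [^]\<^bsub>?G\<^esub> D \<otimes>\<^bsub>?G\<^esub> inv\<^bsub>?G\<^esub> x) \<in> V" if x: "x \<in> \<Gamma>" for x
    proof -
      let ?y = "x \<otimes>\<^bsub>?G\<^esub> g \<otimes>\<^bsub>?G\<^esub> inv\<^bsub>?G\<^esub> x"
      have y: "?y \<in> \<Gamma>" using g x subgroup.m_closed[OF \<Gamma>] subgroup.m_inv_closed[OF \<Gamma>] by simp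
      \<comment> \<open>All conjugates of \<open>g\<close> lie in \<Gamma>, so the single exponent
        \<open>N1\<close> sends each of them into \<open>V\<close> and works for the core as
        well.\<close>
      have "complexify (x \<otimes>\<^bsub>?G\<^esub> g [^]\<^bsub>?G\<^esub> D \<otimes>\<^bsub>?G\<^esub> inv\<^bsub>?G\<^esub> x) = complexify (?y [^]\<^bsub>?G\<^esub> D)"
        using G.conj_nat_pow[OF \<Gamma>G[OF x] \<Gamma>G[OF g]] by metis
      also have "\<dots> = (complexify ?y [^]\<^bsub>?C\<^esub> N1) [^]\<^bsub>?C\<^esub> N6"
        using cx.hom_nat_pow[OF \<Gamma>G[OF y]] C.nat_pow_pow[OF cx.hom_closed[OF \<Gamma>G[OF y]]]
        unfolding D_def by metis
      also have "\<dots> \<in> V" by (rule C.subgroup_nat_pow_closed[OF VC N1(2)[OF imageI[OF y]]])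
      finally show ?thesis .
    qed
    then show ?thesis using g \<Gamma>_pow by (simp add: U_def)
  qed
  have U_V: "complexify u \<in> V" if "u \<in> U" for u
  proof -
    have "u \<in> carrier ?G" using that U\<Gamma> \<Gamma>G by blast
    then have "\<one>\<^bsub>?G\<^esub> \<otimes>\<^bsub>?G\<^esub> u \<otimes>\<^bsub>?G\<^esub> inv\<^bsub>?G\<^esub> \<one>\<^bsub>?G\<^esub> = u" by simp
    then show ?thesis using conj_V[OF that subgroup.one_closed[OF \<Gamma>]] by metis
  qed
  have inv_unique: "h = unital n (inv\<^bsub>?G\<^esub> g)" if "unital n g * h = 1" "g \<in> \<Gamma>" for g h
    using that unital_GL_inv(2)[OF \<Gamma>G[OF that(2)]] by (metis mult.assoc mult_1 mult_1_right)
  interpret unipotent_normal "mat_lattice n" "mat_coords n" "unital n ` \<Gamma>" "unital n ` U" D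
  proof
    show "unital n ` \<Gamma> \<subseteq> mat.one_plus n" using unital_one_plus carrier_GL_D \<Gamma>G by blast
    show "g * h \<in> unital n ` \<Gamma>" if "g \<in> unital n ` \<Gamma>" "h \<in> unital n ` \<Gamma>" for g h
      using that \<Gamma>_simps by (auto simp flip: unital_GL_mult)
    show "1 \<in> unital n ` U" using U_one unital_one[of n] unfolding one_GL by (metis imageI)
    show "\<exists>h\<in>unital n ` \<Gamma>. g * h = 1 \<and> h * g = 1" if "g \<in> unital n ` \<Gamma>" for g
      using that unital_GL_inv[OF \<Gamma>G] subgroup.m_inv_closed[OF \<Gamma>] by (elim imageE) blast
    show "unital n ` U \<subseteq> unital n ` \<Gamma>" using U\<Gamma> by blast
    show "u * v \<in> unital n ` U" if "u \<in> unital n ` U" "v \<in> unital n ` U" for u v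
      using that U_mult U\<Gamma> \<Gamma>G by (auto simp: subset_iff simp flip: unital_GL_mult)
    show "\<exists>v\<in>unital n ` U. u * v = 1 \<and> v * u = 1" if "u \<in> unital n ` U" for u
      using that unital_GL_inv[OF \<Gamma>G[OF subsetD[OF U\<Gamma>]]] U_inv by (elim imageE) blast
    show "g * u * h \<in> unital n ` U"
      if "u \<in> unital n ` U" "g \<in> unital n ` \<Gamma>" "h \<in> unital n ` \<Gamma>" "g * h = 1" for u g h
    proof -
      from that obtain u' g' where *: "u' \<in> U" "g' \<in> \<Gamma>" "u = unital n u'" "g = unital n g'" by blast
      then have "h = unital n (inv\<^bsub>?G\<^esub> g')" using inv_unique that(4) by metis
      then have "g * u * h = unital n (g' \<otimes>\<^bsub>?G\<^esub> u' \<otimes>\<^bsub>?G\<^esub> inv\<^bsub>?G\<^esub> g')"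
        using * U\<Gamma> \<Gamma>G by (simp add: unital_GL_mult subset_iff)
      then show ?thesis using U_conj[OF *(1,2)] by (rule image_eqI)
    qed
    show "0 < D" using N1 N6 by (simp add: D_def)
    show "g ^ D \<in> unital n ` U" if "g \<in> unital n ` \<Gamma>" for g
      using that U_pow \<Gamma>G by (auto simp flip: unital_GL_power)
    show "\<exists>N>0. \<forall>g\<in>unital n ` \<Gamma>. mat.mcong n m (g ^ N) 1" if "0 < m" for m
      using GL_int_exponent_mod[OF that, of n] \<Gamma>G by blast
  qed
  have tf: "x = 1" if "x \<in> unital n ` \<Gamma>" "x ^ D = 1" for x
  proof -
    from that obtain g where g: "g \<in> \<Gamma>" "x = unital n g" by blast
    then have "unital n (g [^]\<^bsub>?G\<^esub> D) = unital n (1\<^sub>m n)"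
      using that \<Gamma>G by (simp add: unital_GL_power unital_one)
    then have "g [^]\<^bsub>?G\<^esub> D = \<one>\<^bsub>?G\<^esub>"
      unfolding one_GL by (rule unital_inj[rotated 2]) (use carrier_GL_D[OF \<Gamma>G[OF \<Gamma>_pow[OF g(1)]]] in auto)
    then have "g = \<one>\<^bsub>?G\<^esub>" using assms(2) g D_pos unfolding torsion_free_def by blast
    then show ?thesis using g by (simp add: one_GL unital_one)
  qed
  have nil: "u - 1 \<in> J n" if "u \<in> unital n ` U" for u
  proof (rule J_I)
    from that obtain g where g: "g \<in> U" "u = unital n g" by blast
    then have gn: "g \<in> carrier_mat n n" using U\<Gamma> \<Gamma>G carrier_GL_D by blast
    have u1: "u - 1 = mat_endo n (g - 1\<^sub>m n)"
      using unital_diff[OF gn, of "1\<^sub>m n"] g by (simp add: unital_one)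
    have g1: "g - 1\<^sub>m n \<in> carrier_mat n n" by (rule minus_carrier_mat[OF one_carrier_mat])
    show "u - 1 \<in> mat_lattice n" unfolding u1 mat_lattice_def by (rule imageI[OF g1])
    fix us assume us: "length us = n" "set us \<subseteq> unital n ` U"
    then have "us \<in> map (unital n) ` lists U" unfolding lists_image[symmetric] by blast
    then obtain vs where vs: "us = map (unital n) vs" "set vs \<subseteq> U" by auto
    then have vn: "set vs \<subseteq> carrier_mat n n" using U\<Gamma> \<Gamma>G carrier_GL_D by blast
    \<comment> \<open>The \<open>n\<close> factors alone already have product 0, whatever the
      leading factor \<open>u - 1\<close>.\<close>
    have "unipotent_prod n vs = 0\<^sub>m n n"
      by (rule unipotent_prod_int_eq_0[OF P(1) vn]) (use us vs P(2) U_V in auto)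
    then show "(u - 1) * prod_list (map (\<lambda>u. u - 1) us) = 0"
      unfolding u1 vs(1) mat_endo_prod_list[OF g1 vn] using g1 by (simp add: mat_endo_zero)
  qed
  obtain m where m: "m > 0" and near: "\<forall>x\<in>unital n ` \<Gamma>. \<forall>t\<in>mat.one_plus n.
      mat.mcong n m t x \<longrightarrow> t ^ D = 1 \<longrightarrow> t = 1"
    using torsion_near_torsion_free[OF tf nil] by blast
  let ?L = "{A \<in> carrier ?G. \<exists>B\<in>\<Gamma>. mat.mcong n m (unital n A) (unital n B)}"
  have "finite_index_subgroup ?L ?G"
  proof (rule finite_index_congruence_hull[OF congruence_hull_subgroup[OF \<Gamma>] m])
    fix A assume "A \<in> carrier ?G" "mat.mcong n m (unital n A) 1"
    then show "A \<in> ?L" using subgroup.one_closed[OF \<Gamma>] unital_one[of n] unfolding one_GL by force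
  qed
  moreover have "torsion_free ?G ?L"
    unfolding torsion_free_def
  proof (intro ballI allI impI)
    fix A and k :: nat
    assume A: "A \<in> ?L" and k: "0 < k" "A [^]\<^bsub>?G\<^esub> k = \<one>\<^bsub>?G\<^esub>"
    then have AG: "A \<in> carrier ?G" by blast
    let ?t = "unital n A"
    have t: "?t \<in> mat.one_plus n" using unital_one_plus carrier_GL_D AG by blast
    have "?t ^ k = 1" using k unital_GL_power[OF AG, of k] by (simp add: one_GL unital_one)
    then have "(?t ^ N6) ^ k = 1" by (metis mult.commute power_mult power_one)
    then have "?t ^ N6 = 1" using mat.mcong_one_torsion mat.power_one_plus t N6(2)[OF AG] k by blast
    then have "?t ^ D = 1" unfolding D_def by (metis mult.commute power_mult power_one)
    then have "?t = unital n (1\<^sub>m n)" using near A t unital_one by auto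
    then show "A = \<one>\<^bsub>?G\<^esub>" unfolding one_GL
      by (rule unital_inj[rotated 2]) (use carrier_GL_D AG in auto)
  qed
  moreover have "\<Gamma> \<subseteq> ?L" using \<Gamma>G mat.mcong_refl by blast
  ultimately show ?thesis by blast
qed

end
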